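(* Let $X=\{X_Q\}_{Q}$ be a family of normalized quasi-Banach function spaces, indexed by the cubes $Q\subset\mathbb{R}^n$. The following statements are equivalent: (i) $\mathrm{BMO}\hookrightarrow \mathrm{BMO}_X$, i.e. there is a constant $C>0$ such that $\|f\|_{\mathrm{BMO}_X}\le C\|f\|_{\mathrm{BMO}}$ for all $f\in\mathrm{BMO}$. (ii) There is a constant $C>0$ such that for any cube $Q$ and any sequence of nested measurable sets $\Omega_k\subset Q$, $k=0,1,2,\dots$ (that is, $\Omega_{k+1}\subset\Omega_k$) satisfying $|\Omega_k|\le 2^{-k}|Q|$ for all $k$, we have $$\Big\|\sum_{k=0}^\infty \chi_{\Omega_k}\Big\|_{X_Q}\le C.$$ (iii) For any cube $Q$ we have $\exp L(Q)\hookrightarrow X_Q$ uniformly in $Q$, i.e. there is a constant $C>0$, independent of $Q$, such that $\|f\|_{X_Q}\le C\|f\|_{\exp L(Q)}$ for every cube $Q$ and every $f\in\exp L(Q)$.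
   Context: Cubes $Q\subset\mathbb{R}^n$ have sides parallel to the axes, and $\langle f\rangle_Q:=\frac1{|Q|}\int_Q f$. A quasi-Banach function space over a cube $Q$ is an order ideal $X_Q$ of the space of measurable functions $Q\to\mathbb{R}$, equipped with a quasi-norm $\|\cdot\|_{X_Q}$, such that: (Compatibility) if $f,g\in X_Q$ and $|f|\le|g|$ then $\|f\|_{X_Q}\le\|g\|_{X_Q}$; (Weak order unit) there is $f\in X_Q$ with $f>0$ a.e.; (Fatou property) if $0\le f_m\uparrow f$ with $f_m \in X_Q$ and $\sup_m\|f_m\|_{X_Q}<\infty$, then $f\in X_Q$ and $\|f\|_{X_Q}=\sup_m\|f_m\|_{X_Q}$. We put $\|f\|_{X_Q}=\infty$ if $f\notin X_Q$; for $f$ defined on $\mathbb{R}^n$, $\|f\|_{X_Q}$ means the quasi-norm of the restriction of $f$ to $Q$. $X=\{X_Q\}$ is a family of normalized quasi-Banach function spaces if for every cube $Q$, $X_Q$ is a quasi-Banach function space over $Q$ and $\|\chi_Q\|_{X_Q}\simeq 1$, with constants independent of $Q$. $\mathrm{BMO}$ is the space of locally integrable $f:\mathbb{R}^n\to\mathbb{R}$ with $\|f\|_{\mathrm{BMO}}:=\sup_Q\frac1{|Q|}\int_Q|f-\langle f\rangle_Q|<\infty$. $\mathrm{BMO}_X$ is the space of locally integrable $f:\mathbb{R}^n\to\mathbb{R}$ with $\|f\|_{\mathrm{BMO}_X}:=\sup_Q\|f-\langle f\rangle_Q\|_{X_Q}<\infty$. $\exp L(Q)$ is the space of measurable $f$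 on $Q$ with $\|f\|_{\exp L(Q)}:=\inf\{\alpha>0:\frac1{|Q|}\int_Q(e^{|f|/\alpha}-1)\,dx\le1\}<\infty$. *)

theory Defs
  imports "HOL-Analysis.Analysis"
begin

definition cubes :: "(real ^ 'n) set set" where
  "cubes = {cbox a (a + (\<chi> i. l)) | a l. 0 < l}"

definition average :: "(real ^ 'n) set \<Rightarrow> (real ^ 'n \<Rightarrow> real) \<Rightarrow> real" where
  "average Q f = (\<integral>x. f x \<partial>lebesgue_on Q) / measure lebesgue Q"

definition locally_integrable :: "(real ^ 'n \<Rightarrow> real) \<Rightarrow> bool" where
  "locally_integrable f \<longleftrightarrow> (\<forall>K. compact K \<longrightarrow> integrable (lebesgue_on K) f)"


section \<open>Quasi-Banach function spaces\<close>

text \<open>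
  Functions on \<open>Q\<close> are represented by total functions. All conditions below are
  relative to \<^term>\<open>lebesgue_on Q\<close> and hold up to null sets, so values outside
  \<open>Q\<close> and on null subsets of \<open>Q\<close> are irrelevant; in particular no restriction
  operator is needed. The value of \<open>qnorm\<close> outside \<open>funs\<close> is meaningless.
\<close>

record 'a fspace =
  funs :: "('a \<Rightarrow> real) set"
  qnorm :: "('a \<Rightarrow> real) \<Rightarrow> real"

text \<open>
  The modulus of concavity in \<open>quasi_triangle\<close> may depend on the space, hence on \<open>Q\<close>.
  Completeness is not listed because it follows from \<open>fatou\<close>.
\<close>

locale quasi_banach_function_space =
  fixes Q :: "(real ^ 'n) set" and V :: "(real ^ 'n) fspace"
  assumes measurable: "f \<in> funs V \<Longrightarrow> f \<in> borel_measurable (lebesgue_on Q)"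
    and zero: "(\<lambda>x. 0) \<in> funs V"
    and add: "f \<in> funs V \<Longrightarrow> g \<in> funs V \<Longrightarrow> (\<lambda>x. f x + g x) \<in> funs V"
    and scale: "f \<in> funs V \<Longrightarrow> (\<lambda>x. c * f x) \<in> funs V"
    and ideal: "g \<in> funs V \<Longrightarrow> f \<in> borel_measurable (lebesgue_on Q) \<Longrightarrow>
      AE x in lebesgue_on Q. \<bar>f x\<bar> \<le> \<bar>g x\<bar> \<Longrightarrow> f \<in> funs V"
    and qnorm_nonneg: "f \<in> funs V \<Longrightarrow> 0 \<le> qnorm V f"
    and qnorm_eq_0: "f \<in> funs V \<Longrightarrow> qnorm V f = 0 \<longleftrightarrow> (AE x in lebesgue_on Q. f x = 0)"
    and qnorm_scale: "f \<in> funs V \<Longrightarrow> qnorm V (\<lambda>x. c * f x) = \<bar>c\<bar> * qnorm V f"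
    and quasi_triangle: "\<exists>K. \<forall>f \<in> funs V. \<forall>g \<in> funs V.
      qnorm V (\<lambda>x. f x + g x) \<le> K * (qnorm V f + qnorm V g)"
    and compatible: "f \<in> funs V \<Longrightarrow> g \<in> funs V \<Longrightarrow>
      AE x in lebesgue_on Q. \<bar>f x\<bar> \<le> \<bar>g x\<bar> \<Longrightarrow> qnorm V f \<le> qnorm V g"
    and weak_order_unit: "\<exists>f \<in> funs V. AE x in lebesgue_on Q. 0 < f x"
    and fatou: "(\<And>m. F m \<in> funs V) \<Longrightarrow> f \<in> borel_measurable (lebesgue_on Q) \<Longrightarrow>
      AE x in lebesgue_on Q. (\<forall>m. 0 \<le> F m x) \<and> incseq (\<lambda>m. F m x) \<and> (\<lambda>m. F m x) \<longlonglongrightarrow> f x \<Longrightarrow>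
      bdd_above (range (\<lambda>m. qnorm V (F m))) \<Longrightarrow>
      f \<in> funs V \<and> qnorm V f = (SUP m. qnorm V (F m))"

definition ext_qnorm :: "'a fspace \<Rightarrow> ('a \<Rightarrow> real) \<Rightarrow> ennreal" where
  "ext_qnorm V f = (if f \<in> funs V then ennreal (qnorm V f) else \<infinity>)"

definition normalized_family :: "((real ^ 'n) set \<Rightarrow> (real ^ 'n) fspace) \<Rightarrow> bool" where
  "normalized_family X \<longleftrightarrow>
    (\<forall>Q \<in> cubes. quasi_banach_function_space Q (X Q)) \<and>
    (\<exists>c C :: real. 0 < c \<and>
      (\<forall>Q \<in> cubes. ennreal c \<le> ext_qnorm (X Q) (indicator Q) \<and>
                   ext_qnorm (X Q) (indicator Q) \<le> ennreal C))"


section \<open>BMO spaces and exponential integrability\<close>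

definition bmo_norm :: "(real ^ 'n \<Rightarrow> real) \<Rightarrow> ennreal" where
  "bmo_norm f = (SUP Q \<in> cubes. ennreal (average Q (\<lambda>x. \<bar>f x - average Q f\<bar>)))"

definition BMO :: "(real ^ 'n \<Rightarrow> real) set" where
  "BMO = {f. locally_integrable f \<and> bmo_norm f < \<infinity>}"

definition bmo_norm_on ::
  "((real ^ 'n) set \<Rightarrow> (real ^ 'n) fspace) \<Rightarrow> (real ^ 'n \<Rightarrow> real) \<Rightarrow> ennreal" where
  "bmo_norm_on X f = (SUP Q \<in> cubes. ext_qnorm (X Q) (\<lambda>x. f x - average Q f))"

definition BMO_on :: "((real ^ 'n) set \<Rightarrow> (real ^ 'n) fspace) \<Rightarrow> (real ^ 'n \<Rightarrow> real) set" where
  "BMO_on X = {f. locally_integrable f \<and> bmo_norm_on X f < \<infinity>}"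

text \<open>
  The integral is the nonnegative one, which is infinite when the exponential is not
  integrable (the Bochner integral would be 0). The infimum over the empty set is \<open>\<infinity>\<close>.
\<close>

definition expL_norm :: "(real ^ 'n) set \<Rightarrow> (real ^ 'n \<Rightarrow> real) \<Rightarrow> ennreal" where
  "expL_norm Q f =
    (INF \<alpha> \<in> {\<alpha> :: real. 0 < \<alpha> \<and>
        (\<integral>\<^sup>+x. ennreal (exp (\<bar>f x\<bar> / \<alpha>) - 1) \<partial>lebesgue_on Q) / emeasure lebesgue Q \<le> 1}.
      ennreal \<alpha>)"

definition expL :: "(real ^ 'n) set \<Rightarrow> (real ^ 'n \<Rightarrow> real) set" where
  "expL Q = {f \<in> borel_measurable (lebesgue_on Q). expL_norm Q f < \<infinity>}"

text \<open>
  The series diverges exactly on the intersection of the sets, where \<open>suminf\<close> takes an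
  unspecified real value. That intersection is null when the measures of the sets tend to 0.
\<close>

definition sum_indicators :: "(nat \<Rightarrow> 'a set) \<Rightarrow> 'a \<Rightarrow> real" where
  "sum_indicators \<Omega> x = (\<Sum>k. indicator (\<Omega> k) x)"

end

theory Submission
  imports Defs
begin

text \<open>
  If (ii) holds, a function whose superlevel sets decay geometrically on \<open>Q\<close> is dominated by a
  multiple of the sum of the indicators of these sets, so it is controlled in \<open>X\<^sub>Q\<close>. For
  \<open>f - \<langle>f\<rangle>\<^sub>Q\<close> with \<open>f\<close> in BMO the decay is the John--Nirenberg inequality; for \<open>f\<close> in \<open>exp L(Q)\<close> it is
  Markov's inequality. This gives (i) and (iii). Conversely, the sum of the indicators in (ii) has
  \<open>exp L\<close> norm at most \<open>1 / ln (4/3)\<close>, which gives (ii) from (iii).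

  For (ii) from (i), take open sets \<open>U\<^sub>k\<close> around \<open>\<Omega>\<^sub>k\<close> of measure at most \<open>2\<^bsup>1-k\<^esup> |Q|\<close> and let \<open>M\<close> be the
  maximal function of the measure with density \<open>\<Sum>\<^sub>k (3/2)\<^sup>k \<chi>(U\<^sub>k)\<close>, whose total mass is at most \<open>8 |Q|\<close>.
  As for Coifman and Rochberg, \<open>log max(1, M)\<close> has bounded mean oscillation by the weak-type
  inequality. It dominates a multiple of \<open>k\<close> on \<open>U\<^sub>k\<close>, even without differentiation of integrals
  because \<open>U\<^sub>k\<close> is open.
\<close>

section \<open>Dyadic cells and stopping families\<close>

text \<open>Two obstacles shape the argument. The modulus of concavity of \<open>X Q\<close> may
  vary with Q, so the quasi-triangle inequality gives no uniform constant; estimates in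
  \<open>X Q\<close> are pointwise comparisons followed by monotonicity and scaling. And BMO tests
  all cubes of the whole space, while a chain lives in one cube and says nothing about oscillation:
  the majorant must be defined everywhere, with an oscillation bound that ignores the sets. The
  logarithm of a maximal function has such a bound for every finite measure, so the measure is free
  to be chosen. Its weights grow fast enough for the logarithm to count the sets, and slowly enough
  against 2^(-k) to keep the total mass comparable to |Q|; the mass in turn bounds the average of
  the majorant over Q, the quantity that (i) subtracts.\<close>

lemma measure_lebesgue_cube:
  fixes a :: "real ^ 'n"
  assumes "0 \<le> l"
  shows "measure lebesgue (cbox a (a + (\<chi> i. l))) = l ^ CARD('n)"
  using assms by (subst measure_completion, simp, subst content_cbox_cart) (auto simp: interval_ne_empty_cart)

lemma emeasure_lebesgue_cbox_eq:
  "emeasure lebesgue (cbox a b) = ennreal (measure lebesgue (cbox a b))"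
  using emeasure_lborel_cbox_finite[of a b] by (intro emeasure_eq_ennreal_measure) (simp add: less_top)

text \<open>Half-open cells of side \<open>l / 2 ^ m\<close>, so each generation is an exact
  partition. Indexing by a point instead of a lattice vector makes the ancestors of a cell the cells
  of the same point at smaller m.\<close>

definition dyadic_cell :: "real ^ 'n \<Rightarrow> real \<Rightarrow> nat \<Rightarrow> real ^ 'n \<Rightarrow> (real ^ 'n) set" where
  "dyadic_cell a l m x = {y. \<forall>i. \<lfloor>(y $ i - a $ i) * 2 ^ m / l\<rfloor> = \<lfloor>(x $ i - a $ i) * 2 ^ m / l\<rfloor>}"

lemma dyadic_cell_refl: "x \<in> dyadic_cell a l m x"
  by (simp add: dyadic_cell_def)

lemma dyadic_cell_eq: "y \<in> dyadic_cell a l m x \<Longrightarrow> dyadic_cell a l m y = dyadic_cell a l m x"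
  by (simp add: dyadic_cell_def)

text \<open>The integer part of t is determined by that of 2t, so a finer cell meets only one
  coarser cell.\<close>

lemma dyadic_cell_Suc_subset: "dyadic_cell a l (Suc m) x \<subseteq> dyadic_cell a l m x"
proof
  fix y assume y: "y \<in> dyadic_cell a l (Suc m) x"
  have le: "\<lfloor>t\<rfloor> \<le> \<lfloor>s\<rfloor>" if "\<lfloor>2 * t\<rfloor> = \<lfloor>2 * s\<rfloor>" for t s :: real
  proof -
    have "2 * \<lfloor>t\<rfloor> \<le> \<lfloor>2 * s\<rfloor>"
      unfolding that[symmetric] le_floor_iff using of_int_floor_le[of t] by simp
    then show ?thesis
      by (simp add: le_floor_iff)
  qed
  have half: "\<lfloor>t\<rfloor> = \<lfloor>s\<rfloor>" if "\<lfloor>2 * t\<rfloor> = \<lfloor>2 * s\<rfloor>" for t s :: real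
    using le[OF that] le[OF that[symmetric]] by simp
  show "y \<in> dyadic_cell a l m x"
    unfolding dyadic_cell_def
  proof (intro CollectI allI, rule half)
    fix i
    show "\<lfloor>2 * ((y $ i - a $ i) * 2 ^ m / l)\<rfloor> = \<lfloor>2 * ((x $ i - a $ i) * 2 ^ m / l)\<rfloor>"
      using y by (simp add: dyadic_cell_def mult.commute mult.left_commute)
  qed
qed

lemma dyadic_cell_antimono: "m \<le> m' \<Longrightarrow> dyadic_cell a l m' x \<subseteq> dyadic_cell a l m x"
  by (rule lift_Suc_antimono_le[of "\<lambda>m. dyadic_cell a l m x"]) (rule dyadic_cell_Suc_subset)

lemma dyadic_cell_box:
  fixes a x :: "real ^ 'n"
  assumes "0 < l"
  obtains v where "box v (v + (\<chi> i. l / 2 ^ m)) \<subseteq> dyadic_cell a l m x"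
    and "dyadic_cell a l m x \<subseteq> cbox v (v + (\<chi> i. l / 2 ^ m))"
proof
  let ?z = "\<lambda>i. \<lfloor>(x $ i - a $ i) * 2 ^ m / l\<rfloor>"
  let ?v = "(\<chi> i. a $ i + l / 2 ^ m * ?z i) :: real ^ 'n"
  have iff: "(\<lfloor>(t - b) * 2 ^ m / l\<rfloor> = z) = (b + l / 2 ^ m * of_int z \<le> t \<and> t < b + l / 2 ^ m * of_int z + l / 2 ^ m)"
    for t b :: real and z :: int
    using assms by (simp add: floor_eq_iff field_simps)
  show "box ?v (?v + (\<chi> i. l / 2 ^ m)) \<subseteq> dyadic_cell a l m x"
    by (auto simp: dyadic_cell_def mem_box_cart iff intro: less_imp_le)
  show "dyadic_cell a l m x \<subseteq> cbox ?v (?v + (\<chi> i. l / 2 ^ m))"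
    unfolding dyadic_cell_def subset_eq mem_box_cart mem_Collect_eq iff by (simp add: less_imp_le)
qed

lemma negligible_cbox_diff_dyadic_cell:
  assumes "box v w \<subseteq> dyadic_cell a l m x"
  shows "negligible (cbox v w - dyadic_cell a l m x)"
  by (rule negligible_subset[OF negligible_frontier_interval[of v w]]) (use assms in auto)

lemma sets_dyadic_cell [measurable]:
  fixes a x :: "real ^ 'n"
  shows "dyadic_cell a l m x \<in> sets lebesgue"
proof -
  have "dyadic_cell a l m x = (\<Inter>i. {y \<in> space borel. \<lfloor>(y $ i - a $ i) * 2 ^ m / l\<rfloor> = \<lfloor>(x $ i - a $ i) * 2 ^ m / l\<rfloor>})"
    by (auto simp: dyadic_cell_def)
  also have "\<dots> \<in> sets borel"
    by measurable
  finally show ?thesis by simp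
qed

lemma emeasure_dyadic_cell:
  fixes a x :: "real ^ 'n"
  assumes "0 < l"
  shows "emeasure lebesgue (dyadic_cell a l m x) = ennreal ((l / 2 ^ m) ^ CARD('n))"
proof -
  obtain v where v: "box v (v + (\<chi> i. l / 2 ^ m)) \<subseteq> dyadic_cell a l m x"
    "dyadic_cell a l m x \<subseteq> cbox v (v + (\<chi> i. l / 2 ^ m))"
    using dyadic_cell_box[OF assms] by blast
  let ?Q = "cbox v (v + (\<chi> i. l / 2 ^ m))"
  have "emeasure lebesgue (dyadic_cell a l m x) = emeasure lebesgue (?Q - (?Q - dyadic_cell a l m x))"
    using v(2) by (simp add: double_diff)
  also have "\<dots> = emeasure lebesgue ?Q"
    using negligible_cbox_diff_dyadic_cell[OF v(1)]
    by (intro emeasure_Diff_null_set) (auto simp: negligible_iff_null_sets)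
  also have "\<dots> = ennreal ((l / 2 ^ m) ^ CARD('n))"
    using assms by (subst emeasure_lebesgue_cbox_eq, subst measure_lebesgue_cube) auto
  finally show ?thesis .
qed

lemma countable_dyadic_cells: "countable {dyadic_cell a l m x | m x. True}"
proof (rule countable_subset)
  show "{dyadic_cell a l m x | m x. True}
    \<subseteq> range (\<lambda>(m, v :: int ^ 'a). {y. \<forall>i. \<lfloor>(y $ i - a $ i) * 2 ^ m / l\<rfloor> = v $ i})"
  proof clarify
    fix m x
    show "dyadic_cell a l m x \<in> range (\<lambda>(m, v :: int ^ 'a). {y. \<forall>i. \<lfloor>(y $ i - a $ i) * 2 ^ m / l\<rfloor> = v $ i})"
      by (rule range_eqI[of _ _ "(m, \<chi> i. \<lfloor>(x $ i - a $ i) * 2 ^ m / l\<rfloor>)"]) (simp add: dyadic_cell_def)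
  qed
qed simp

definition stopping_cells :: "real ^ 'n \<Rightarrow> real \<Rightarrow> ((real ^ 'n) set \<Rightarrow> bool) \<Rightarrow> (real ^ 'n) set set" where
  "stopping_cells a l P =
    {dyadic_cell a l m x | m x. P (dyadic_cell a l m x) \<and> (\<forall>j<m. \<not> P (dyadic_cell a l j x))}"

lemma countable_stopping_cells: "countable (stopping_cells a l P)"
  by (rule countable_subset[OF _ countable_dyadic_cells[of a l]]) (auto simp: stopping_cells_def)

lemma sets_stopping_cells: "S \<in> stopping_cells a l P \<Longrightarrow> S \<in> sets lebesgue"
  by (auto simp: stopping_cells_def)

text \<open>A common point z has only one first generation at which its cell satisfies P, and both
  cells are the cell of z at that generation.\<close>

lemma disjoint_stopping_cells: "disjoint (stopping_cells a l P)"
proof (rule disjointI)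
  fix S T assume S: "S \<in> stopping_cells a l P" and T: "T \<in> stopping_cells a l P" and "S \<noteq> T"
  show "S \<inter> T = {}"
  proof (rule ccontr)
    assume "S \<inter> T \<noteq> {}"
    then obtain z where z: "z \<in> S" "z \<in> T" by auto
    obtain m x where mx: "S = dyadic_cell a l m x" "P S" "\<forall>j<m. \<not> P (dyadic_cell a l j x)"
      using S by (auto simp: stopping_cells_def)
    obtain k y where ky: "T = dyadic_cell a l k y" "P T" "\<forall>j<k. \<not> P (dyadic_cell a l j y)"
      using T by (auto simp: stopping_cells_def)
    have Sz: "dyadic_cell a l j z = dyadic_cell a l j x" if "j \<le> m" for j
      using dyadic_cell_antimono[OF that] z mx(1) dyadic_cell_eq by blast
    have Tz: "dyadic_cell a l j z = dyadic_cell a l j y" if "j \<le> k" for j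
      using dyadic_cell_antimono[OF that] z ky(1) dyadic_cell_eq by blast
    have "m = k"
      using Sz Tz mx ky by (metis linorder_neqE_nat less_imp_le order_refl)
    then show False
      using \<open>S \<noteq> T\<close> Sz[of m] Tz[of k] mx ky by simp
  qed
qed

lemma Union_stopping_cells: "\<Union> (stopping_cells a l P) = {x. \<exists>m. P (dyadic_cell a l m x)}"
proof (intro equalityI subsetI)
  fix z assume "z \<in> \<Union> (stopping_cells a l P)"
  then show "z \<in> {x. \<exists>m. P (dyadic_cell a l m x)}"
    by (auto simp: stopping_cells_def) (metis dyadic_cell_eq)
next
  fix x assume "x \<in> {x. \<exists>m. P (dyadic_cell a l m x)}"
  then obtain m where "P (dyadic_cell a l m x)" by auto
  then have "P (dyadic_cell a l (LEAST m. P (dyadic_cell a l m x)) x)"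
    by (rule LeastI)
  moreover have "\<forall>j<(LEAST m. P (dyadic_cell a l m x)). \<not> P (dyadic_cell a l j x)"
    using not_less_Least by blast
  ultimately show "x \<in> \<Union> (stopping_cells a l P)"
    unfolding stopping_cells_def using dyadic_cell_refl by blast
qed

section \<open>Comparing measures on unions of disjoint cells\<close>

lemma emeasure_Union_disjoint:
  assumes "countable D" "disjoint D" "D \<subseteq> sets M"
  shows "emeasure M (\<Union>D) = (\<integral>\<^sup>+S. emeasure M S \<partial>count_space D)"
proof -
  have "emeasure M (\<Union>S\<in>D. S) = (\<integral>\<^sup>+S. emeasure M S \<partial>count_space D)"
    using assms by (intro emeasure_UN_countable) (auto simp: disjoint_family_on_def disjoint_def)
  then show ?thesis by simp
qed

lemma emeasure_Union_disjoint_le: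
  assumes "countable D" "disjoint D" "D \<subseteq> sets M" "D \<subseteq> sets N"
    and "\<And>S. S \<in> D \<Longrightarrow> emeasure M S \<le> c * emeasure N S"
  shows "emeasure M (\<Union>D) \<le> c * emeasure N (\<Union>D)"
proof -
  have "emeasure M (\<Union>D) \<le> (\<integral>\<^sup>+S. c * emeasure N S \<partial>count_space D)"
    unfolding emeasure_Union_disjoint[OF assms(1,2,3)] using assms(5) by (intro nn_integral_mono) auto
  also have "\<dots> = c * emeasure N (\<Union>D)"
    unfolding emeasure_Union_disjoint[OF assms(1,2,4)] by (simp add: nn_integral_cmult)
  finally show ?thesis .
qed

lemma dyadic_cell_subset_open:
  fixes a x :: "real ^ 'n"
  assumes "0 < l" "open U" "x \<in> U"
  obtains m where "dyadic_cell a l m x \<subseteq> U"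
proof -
  obtain e where e: "0 < e" "ball x e \<subseteq> U"
    using assms(2,3) openE by blast
  obtain m where m: "CARD('n) * l / e < 2 ^ m"
    using real_arch_pow[of 2] by auto
  have "dyadic_cell a l m x \<subseteq> ball x e"
  proof
    fix y assume y: "y \<in> dyadic_cell a l m x"
    obtain v where v: "dyadic_cell a l m x \<subseteq> cbox v (v + (\<chi> i. l / 2 ^ m))"
      using dyadic_cell_box[OF assms(1)] by blast
    have "\<bar>(x - y) $ i\<bar> \<le> l / 2 ^ m" for i
    proof -
      have "x \<in> cbox v (v + (\<chi> i. l / 2 ^ m))" "y \<in> cbox v (v + (\<chi> i. l / 2 ^ m))"
        using v y dyadic_cell_refl by blast+
      then have "v $ i \<le> x $ i \<and> x $ i \<le> v $ i + l / 2 ^ m" "v $ i \<le> y $ i \<and> y $ i \<le> v $ i + l / 2 ^ m"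
        by (auto simp: mem_box_cart)
      then show ?thesis by auto
    qed
    then have "norm (x - y) \<le> (\<Sum>i\<in>(UNIV :: 'n set). l / 2 ^ m)"
      by (intro order_trans[OF norm_le_l1_cart] sum_mono) auto
    also have "\<dots> < e"
      using m e(1) by (simp add: field_simps)
    finally show "y \<in> ball x e"
      by (simp add: dist_norm)
  qed
  then show ?thesis using e that by blast
qed

text \<open>This takes the place of the Lebesgue differentiation theorem: the set is covered by disjoint
  cells inside an open set of almost the same measure.\<close>

lemma emeasure_le_of_dyadic_cells:
  fixes a :: "real ^ 'n"
  assumes "0 < l" and A: "A \<in> sets lebesgue" and M: "sets M = sets lebesgue"
    and le: "\<And>x m. x \<in> A \<Longrightarrow> emeasure M (dyadic_cell a l m x) \<le> ennreal c * emeasure lebesgue (dyadic_cell a l m x)"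
  shows "emeasure M A \<le> ennreal c * emeasure lebesgue A"
proof (rule ennreal_le_epsilon)
  fix e :: real assume "0 < e"
  \<comment> \<open>The maximum with 1 makes \<open>c * d \<le> e\<close> hold for small c as
    well.\<close>
  define d where "d = e / max 1 c"
  have d: "0 < d" "ennreal c * ennreal d \<le> ennreal e"
    using \<open>0 < e\<close> by (auto simp: d_def ennreal_mult''[symmetric] field_simps max_def intro!: ennreal_leI)
  obtain U where U: "open U" "A \<subseteq> U" "(U - A) \<in> lmeasurable" "emeasure lebesgue (U - A) < ennreal d"
    using sets_lebesgue_outer_open[OF A d(1)] by blast
  \<comment> \<open>Cells that miss A are discarded because the density bound is known only for
    cells of points of A.\<close>
  define D where "D = stopping_cells a l (\<lambda>S. S \<subseteq> U) \<inter> {S. S \<inter> A \<noteq> {}}"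
  have D: "countable D" "disjoint D" "D \<subseteq> sets lebesgue"
    using countable_stopping_cells[of a l "\<lambda>S. S \<subseteq> U"] disjoint_stopping_cells[of a l "\<lambda>S. S \<subseteq> U"]
    by (auto simp: D_def sets_stopping_cells intro: countable_subset pairwise_subset)
  have "A \<subseteq> \<Union>D"
  proof
    fix x assume "x \<in> A"
    then obtain m where "dyadic_cell a l m x \<subseteq> U"
      using dyadic_cell_subset_open[OF assms(1) U(1)] U(2) by blast
    then have "x \<in> \<Union> (stopping_cells a l (\<lambda>S. S \<subseteq> U))"
      unfolding Union_stopping_cells by blast
    then show "x \<in> \<Union>D"
      using \<open>x \<in> A\<close> by (auto simp: D_def)
  qed
  then have "emeasure M A \<le> emeasure M (\<Union>D)"
    using D M by (intro emeasure_mono) (auto intro!: sets.countable_Union)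
  also have "\<dots> \<le> ennreal c * emeasure lebesgue (\<Union>D)"
  proof (rule emeasure_Union_disjoint_le[OF D(1,2)])
    fix S assume "S \<in> D"
    then obtain x y m where "x \<in> A" "x \<in> S" "S = dyadic_cell a l m y"
      by (auto simp: D_def stopping_cells_def)
    then have "x \<in> A" "S = dyadic_cell a l m x"
      by (simp_all add: dyadic_cell_eq)
    then show "emeasure M S \<le> ennreal c * emeasure lebesgue S"
      using le by simp
  qed (use D M in auto)
  also have "emeasure lebesgue (\<Union>D) \<le> emeasure lebesgue U"
    using U(1) by (intro emeasure_mono) (auto simp: D_def stopping_cells_def)
  also have "emeasure lebesgue U \<le> emeasure lebesgue A + ennreal d"
  proof -
    have "emeasure lebesgue U = emeasure lebesgue (A \<union> (U - A))"
      using U(2) by (simp add: Un_absorb1)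
    also have "\<dots> \<le> emeasure lebesgue A + emeasure lebesgue (U - A)"
      using A U(3) by (intro emeasure_subadditive) auto
    finally show ?thesis
      using U(4) by (meson add_left_mono less_imp_le order_trans)
  qed
  also have "ennreal c * (emeasure lebesgue A + ennreal d) \<le> ennreal c * emeasure lebesgue A + ennreal e"
    using d(2) by (simp add: distrib_left)
  finally show "emeasure M A \<le> ennreal c * emeasure lebesgue A + ennreal e"
    by (simp add: mult_left_mono)
qed

section \<open>Oscillation on cubes and the John--Nirenberg inequality\<close>

lemma cbox_in_cubes: "0 < l \<Longrightarrow> cbox a (a + (\<chi> i. l)) \<in> cubes"
  unfolding cubes_def by blast

lemma cubeE:
  assumes "Q \<in> cubes"
  obtains a l where "0 < l" "Q = cbox a (a + (\<chi> i. l))"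
  using assms by (auto simp: cubes_def)

lemma
  assumes "Q \<in> cubes"
  shows sets_cube: "Q \<in> sets lebesgue"
    and emeasure_cube: "emeasure lebesgue Q = ennreal (measure lebesgue Q)"
    and measure_cube_pos: "0 < measure lebesgue Q"
    and compact_cube: "compact Q"
  using assms
  by (auto elim!: cubeE simp: emeasure_lebesgue_cbox_eq measure_lebesgue_cube simp del: emeasure_completion measure_completion)

lemma integrable_on_cube: "locally_integrable f \<Longrightarrow> Q \<in> cubes \<Longrightarrow> integrable (lebesgue_on Q) f"
  by (simp add: locally_integrable_def compact_cube)

lemma finite_measure_lebesgue_on_cube: "Q \<in> cubes \<Longrightarrow> finite_measure (lebesgue_on Q)"
  by (intro finite_measureI) (simp add: emeasure_restrict_space emeasure_cube space_restrict_space sets_cube del: emeasure_completion)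

lemma integrable_const_cube: "Q \<in> cubes \<Longrightarrow> integrable (lebesgue_on Q) (\<lambda>x. c :: real)"
  using finite_measure.integrable_const[OF finite_measure_lebesgue_on_cube] .

lemma nn_integral_cube_eq_average:
  assumes "Q \<in> cubes" "integrable (lebesgue_on Q) g"
  shows "(\<integral>\<^sup>+x. ennreal \<bar>g x\<bar> * indicator Q x \<partial>lebesgue) = ennreal (average Q (\<lambda>x. \<bar>g x\<bar>)) * emeasure lebesgue Q"
proof -
  have "(\<integral>\<^sup>+x. ennreal \<bar>g x\<bar> * indicator Q x \<partial>lebesgue) = (\<integral>\<^sup>+x. ennreal \<bar>g x\<bar> \<partial>lebesgue_on Q)"
    using assms(1) by (subst nn_integral_restrict_space) (auto simp: sets_cube)
  also have "\<dots> = ennreal (\<integral>x. \<bar>g x\<bar> \<partial>lebesgue_on Q)"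
    using assms(2) by (intro nn_integral_eq_integral) auto
  also have "\<dots> = ennreal (average Q (\<lambda>x. \<bar>g x\<bar>)) * emeasure lebesgue Q"
    using measure_cube_pos[OF assms(1)]
    by (simp add: average_def emeasure_cube[OF assms(1)] ennreal_mult''[symmetric] del: emeasure_completion measure_completion)
  finally show ?thesis .
qed

lemma average_diff_const:
  assumes "Q \<in> cubes" "integrable (lebesgue_on Q) f"
  shows "average Q (\<lambda>x. f x - c) = average Q f - c"
  using assms measure_cube_pos[OF assms(1)]
  by (simp add: average_def integrable_const_cube diff_divide_distrib measure_restrict_space sets_cube space_restrict_space del: measure_completion)

lemma abs_average_diff_le:
  assumes "Q \<in> cubes" "integrable (lebesgue_on Q) f"
  shows "\<bar>average Q f - c\<bar> \<le> average Q (\<lambda>x. \<bar>f x - c\<bar>)"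
proof -
  have "\<bar>average Q (\<lambda>x. f x - c)\<bar> \<le> average Q (\<lambda>x. \<bar>f x - c\<bar>)"
    using measure_cube_pos[OF assms(1)] integral_abs_bound[of "lebesgue_on Q" "\<lambda>x. f x - c"]
    by (simp add: average_def divide_right_mono del: measure_completion)
  then show ?thesis by (simp add: average_diff_const assms)
qed

text \<open>The function \<open>g - c\<close> is positive on A and its integral over A turns out to
  be 0; finiteness of the measure of A permits the cancellation.\<close>

lemma null_set_of_integral_le:
  assumes A: "A \<in> sets M" "emeasure M A < \<infinity>" and g: "g \<in> borel_measurable M"
    and gt: "\<And>x. x \<in> A \<Longrightarrow> c < g x" and "0 \<le> c"
    and le: "(\<integral>\<^sup>+x. ennreal (g x) * indicator A x \<partial>M) \<le> ennreal c * emeasure M A"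
  shows "emeasure M A = 0"
proof -
  have "(\<integral>\<^sup>+x. ennreal (g x) * indicator A x \<partial>M)
      = (\<integral>\<^sup>+x. ennreal (g x - c) * indicator A x + ennreal c * indicator A x \<partial>M)"
    using gt \<open>0 \<le> c\<close>
    by (intro nn_integral_cong) (auto simp: indicator_def ennreal_plus[symmetric] less_imp_le simp del: ennreal_plus)
  also have "\<dots> = (\<integral>\<^sup>+x. ennreal (g x - c) * indicator A x \<partial>M) + ennreal c * emeasure M A"
    using A g by (subst nn_integral_add) (auto simp: nn_integral_cmult_indicator)
  finally have "(\<integral>\<^sup>+x. ennreal (g x - c) * indicator A x \<partial>M) + ennreal c * emeasure M A \<le> 0 + ennreal c * emeasure M A"
    using le by simp
  then have "ennreal c * emeasure M A + (\<integral>\<^sup>+x. ennreal (g x - c) * indicator A x \<partial>M) \<le> ennreal c * emeasure M A + 0"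
    by (simp add: add.commute)
  then have "(\<integral>\<^sup>+x. ennreal (g x - c) * indicator A x \<partial>M) = 0"
    unfolding ennreal_add_left_cancel_le
    using A(2) by (auto simp: ennreal_mult_eq_top_iff)
  then have "AE x in M. ennreal (g x - c) * indicator A x = 0"
    using A g by (subst (asm) nn_integral_0_iff_AE) auto
  then have "AE x in M. x \<notin> A"
    by eventually_elim (use gt in \<open>force simp: indicator_def ennreal_eq_0_iff split: if_splits\<close>)
  then show ?thesis
    using A(1) AE_iff_null_sets null_setsD1 by blast
qed

lemma dyadic_cell_0:
  fixes a :: "real ^ 'n"
  assumes "0 < l"
  shows "box a (a + (\<chi> i. l)) \<subseteq> dyadic_cell a l 0 a" "dyadic_cell a l 0 a \<subseteq> cbox a (a + (\<chi> i. l))"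
proof -
  have iff: "\<lfloor>(t - b) / l\<rfloor> = 0 \<longleftrightarrow> b \<le> t \<and> t < b + l" for t b :: real
    using assms by (simp add: floor_eq_iff field_simps)
  show "box a (a + (\<chi> i. l)) \<subseteq> dyadic_cell a l 0 a"
    by (auto simp: dyadic_cell_def mem_box_cart iff less_imp_le)
  show "dyadic_cell a l 0 a \<subseteq> cbox a (a + (\<chi> i. l))"
    unfolding dyadic_cell_def subset_eq mem_box_cart mem_Collect_eq by (simp add: iff less_imp_le)
qed

lemma emeasure_dyadic_cell_Suc:
  fixes a :: "real ^ 'n"
  assumes "0 < l"
  shows "emeasure lebesgue (dyadic_cell a l m x) = ennreal (2 ^ CARD('n)) * emeasure lebesgue (dyadic_cell a l (Suc m) y)"
  using assms by (simp add: emeasure_dyadic_cell ennreal_mult'[symmetric] power_mult_distrib power_divide del: emeasure_completion)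

lemma sets_cube_superlevel:
  fixes f :: "real ^ 'n \<Rightarrow> real"
  assumes "Q \<in> cubes" "f \<in> borel_measurable (lebesgue_on Q)"
  shows "{x \<in> Q. c < \<bar>f x - d\<bar>} \<in> sets lebesgue"
proof -
  have "{x \<in> space (lebesgue_on Q). c < \<bar>f x - d\<bar>} \<in> sets (lebesgue_on Q)"
    using assms(2) by measurable
  then show ?thesis
    using sets_cube[OF assms(1)] by (auto simp: sets_restrict_space_iff space_restrict_space)
qed

text \<open>Induction on k for all cubes at once. Cells selected at height 2b for
  \<open>|f - average Q f|\<close> fill at most half of Q, since the mean over Q is at most b. The
  parent of a selected cell is not selected, which bounds the mean over the cell by
  \<open>2 ^ CARD('n) * (2 * b)\<close>. Exchanging the average over Q for that over the cell
  therefore costs at most one level, and the induction hypothesis on the cell supplies the other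
  factors 1/2.\<close>

lemma John_Nirenberg:
  fixes f :: "real ^ 'n \<Rightarrow> real"
  assumes f: "locally_integrable f" and b: "0 < b"
    and bmo: "\<And>Q. Q \<in> cubes \<Longrightarrow> average Q (\<lambda>x. \<bar>f x - average Q f\<bar>) \<le> b"
    and "Q \<in> cubes"
  shows "emeasure lebesgue {x \<in> Q. real k * (2 ^ (CARD('n) + 1) * b) < \<bar>f x - average Q f\<bar>}
    \<le> ennreal ((1 / 2) ^ k) * emeasure lebesgue Q"
  using \<open>Q \<in> cubes\<close>
proof (induction k arbitrary: Q)
  case 0
  then show ?case by (auto intro!: emeasure_mono simp: sets_cube simp del: emeasure_completion)
next
  case (Suc k)
  note Q = Suc.prems
  define c where "c = 2 ^ (CARD('n) + 1) * b"
  have c: "2 * b \<le> c" "0 < c"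
    using b by (auto simp: c_def)
  obtain a l where l: "0 < l" and Q_eq: "Q = cbox a (a + (\<chi> i. l))"
    using Q cubeE by blast
  define R where "R = dyadic_cell a l 0 a"
  have RQ: "R \<subseteq> Q"
    unfolding R_def Q_eq using dyadic_cell_0(2)[OF l] .
  have QR: "negligible (Q - R)"
    unfolding R_def Q_eq using negligible_cbox_diff_dyadic_cell[OF dyadic_cell_0(1)[OF l]] .
  define F where "F x = f x - average Q f" for x
  define g where "g x = indicator Q x *\<^sub>R F x" for x
  have F: "integrable (lebesgue_on Q) F"
    unfolding F_def using integrable_on_cube[OF f Q] integrable_const_cube[OF Q] by auto
  have g [measurable]: "g \<in> borel_measurable lebesgue"
    unfolding g_def using borel_measurable_integrable[OF F] Q
    by (subst borel_measurable_restrict_space_iff[symmetric]) (auto simp: sets_cube)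
  define M where "M = density lebesgue (\<lambda>x. ennreal \<bar>g x\<bar>)"
  have M: "sets M = sets lebesgue"
    by (simp add: M_def)
  have emM: "emeasure M S = (\<integral>\<^sup>+x. ennreal \<bar>F x\<bar> * indicator S x \<partial>lebesgue)" if "S \<in> sets lebesgue" "S \<subseteq> Q" for S
    unfolding M_def using that
    by (subst emeasure_density, measurable) (auto simp: g_def indicator_def intro!: nn_integral_cong)
  have emMQ: "emeasure M Q \<le> ennreal b * emeasure lebesgue Q"
    using nn_integral_cube_eq_average[OF Q F] bmo[OF Q] emM[OF sets_cube[OF Q]]
    by (auto simp: F_def intro!: mult_right_mono ennreal_leI simp del: emeasure_completion)
  \<comment> \<open>The clause \<open>S \<subseteq> R\<close> keeps selected cells inside Q, where
    the density of M is |F|.\<close>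
  define P where "P S \<longleftrightarrow> S \<subseteq> R \<and> ennreal (2 * b) * emeasure lebesgue S < emeasure M S" for S
  define D where "D = stopping_cells a l P"
  have D: "countable D" "disjoint D" "D \<subseteq> sets lebesgue"
    unfolding D_def by (auto simp: countable_stopping_cells disjoint_stopping_cells sets_stopping_cells)
  have UD [measurable]: "\<Union>D \<in> sets lebesgue"
    using D by (auto intro!: sets.countable_Union)
  have P_D: "P S" if "S \<in> D" for S
    using that by (auto simp: D_def stopping_cells_def)
  define E where "E = {x \<in> Q. real (Suc k) * c < \<bar>F x\<bar>}"
  have E [measurable]: "E \<in> sets lebesgue"
    unfolding E_def using sets_cube_superlevel[OF Q borel_measurable_integrable[OF F], of _ 0] by simp

  have S_bound: "emeasure lebesgue (E \<inter> S) \<le> ennreal ((1 / 2) ^ k) * emeasure lebesgue S" if S_D: "S \<in> D" for S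
  proof -
    obtain m x where S_eq: "S = dyadic_cell a l m x" and stop: "\<And>j. j < m \<Longrightarrow> \<not> P (dyadic_cell a l j x)"
      using S_D unfolding D_def stopping_cells_def by blast
    have S: "S \<in> sets lebesgue" "S \<subseteq> Q" "S \<subseteq> R" "x \<in> R"
      using P_D[OF S_D] RQ dyadic_cell_refl[of x a l m] by (auto simp: P_def S_eq)
    then have R_eq: "dyadic_cell a l 0 x = R"
      unfolding R_def using dyadic_cell_eq by blast
    \<comment> \<open>The mean of |F| over R is at most b, below the height 2b. Hence a selected
      cell is never R itself and has a parent inside R.\<close>
    have "\<not> P R"
    proof -
      have "emeasure lebesgue Q = emeasure lebesgue R"
        using QR RQ emeasure_Un_null_set[of R lebesgue "Q - R"]
        by (simp add: negligible_iff_null_sets R_def Un_absorb1 del: emeasure_completion)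
      moreover have "emeasure M R \<le> emeasure M Q"
        using RQ Q by (intro emeasure_mono) (auto simp: M sets_cube)
      moreover have "ennreal b * emeasure lebesgue R \<le> ennreal (2 * b) * emeasure lebesgue R"
        using b by (intro mult_right_mono ennreal_leI) auto
      ultimately have "emeasure M R \<le> ennreal (2 * b) * emeasure lebesgue R"
        using emMQ by (metis order_trans)
      then show ?thesis
        by (simp add: P_def not_less del: emeasure_completion)
    qed
    then have "m \<noteq> 0"
      using P_D[OF S_D] S_eq R_eq by metis
    then obtain j where m: "m = Suc j"
      using not0_implies_Suc by blast
    let ?T = "dyadic_cell a l j x"
    have T: "?T \<subseteq> R"
      using dyadic_cell_antimono[of 0 j a l x] R_eq by simp
    have "emeasure M S \<le> emeasure M ?T"
      unfolding S_eq m by (intro emeasure_mono dyadic_cell_Suc_subset) (simp add: M)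
    also have "\<dots> \<le> ennreal (2 * b) * emeasure lebesgue ?T"
      using stop[of j] T by (simp add: m P_def not_less del: emeasure_completion)
    also have "\<dots> = ennreal c * emeasure lebesgue S"
      unfolding S_eq m using emeasure_dyadic_cell_Suc[OF l, of a j x x] b
      by (simp add: c_def ennreal_mult'' mult_ac del: emeasure_completion)
    finally have MS: "emeasure M S \<le> ennreal c * emeasure lebesgue S" .
    obtain v where v: "box v (v + (\<chi> i. l / 2 ^ m)) \<subseteq> S" "S \<subseteq> cbox v (v + (\<chi> i. l / 2 ^ m))"
      unfolding S_eq using dyadic_cell_box[OF l] by blast
    \<comment> \<open>Averages and the induction hypothesis refer to closed cubes; S' differs from S
      by a null set.\<close>
    define S' where "S' = cbox v (v + (\<chi> i. l / 2 ^ m))"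
    have S': "S' \<in> cubes"
      unfolding S'_def using l by (intro cbox_in_cubes) simp
    have null: "AE x in lebesgue. x \<in> S \<longleftrightarrow> x \<in> S'"
      using negligible_cbox_diff_dyadic_cell[OF v(1)[unfolded S_eq]] v(2)
      by (intro AE_I'[of "S' - S"]) (auto simp: S'_def S_eq negligible_iff_null_sets)
    have meas: "emeasure lebesgue S' = emeasure lebesgue S"
      using null S S' by (intro emeasure_eq_AE) (auto simp: sets_cube)
    have F': "integrable (lebesgue_on S') F"
      unfolding F_def using integrable_on_cube[OF f S'] integrable_const_cube[OF S'] by auto
    have "ennreal (average S' (\<lambda>x. \<bar>F x\<bar>)) * emeasure lebesgue S' = (\<integral>\<^sup>+x. ennreal \<bar>F x\<bar> * indicator S' x \<partial>lebesgue)"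
      using nn_integral_cube_eq_average[OF S' F'] by simp
    also have "\<dots> = (\<integral>\<^sup>+x. ennreal \<bar>F x\<bar> * indicator S x \<partial>lebesgue)"
      using null by (intro nn_integral_cong_AE) (auto simp: indicator_def elim!: eventually_mono)
    also have "\<dots> \<le> ennreal c * emeasure lebesgue S'"
      using MS S by (simp add: emM meas del: emeasure_completion)
    finally have "average S' (\<lambda>x. \<bar>F x\<bar>) \<le> c"
      using measure_cube_pos[OF S'] c(2) 
      by (simp add: emeasure_cube[OF S'] ennreal_mult''[symmetric] ennreal_le_iff del: emeasure_completion measure_completion)
    then have avg: "\<bar>average S' f - average Q f\<bar> \<le> c"
      using abs_average_diff_le[OF S' integrable_on_cube[OF f S'], of "average Q f"] by (simp add: F_def)
    \<comment> \<open>The averages over S' and Q differ by at most c, so a deviation of more than k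
      + 1 levels from one is a deviation of more than k levels from the other.\<close>
    have "E \<inter> S \<subseteq> {x \<in> S'. real k * c < \<bar>f x - average S' f\<bar>}"
      using avg v(2) by (auto simp: E_def F_def S'_def algebra_simps)
    then have "emeasure lebesgue (E \<inter> S) \<le> emeasure lebesgue {x \<in> S'. real k * c < \<bar>f x - average S' f\<bar>}"
      using sets_cube_superlevel[OF S' borel_measurable_integrable[OF integrable_on_cube[OF f S']]]
      by (intro emeasure_mono) auto
    also have "\<dots> \<le> ennreal ((1 / 2) ^ k) * emeasure lebesgue S"
      using Suc.IH[OF S'] by (simp add: c_def meas del: emeasure_completion)
    finally show ?thesis .
  qed

  \<comment> \<open>On this unselected part |F| exceeds c and hence 2b, but every cell around one of
    its points has density at most 2b. So it is null.\<close>
  define A where "A = (E \<inter> R) - \<Union>D"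
  have A: "A \<in> sets lebesgue" "A \<subseteq> Q"
    using RQ by (auto simp: A_def R_def)
  have "emeasure M A \<le> ennreal (2 * b) * emeasure lebesgue A"
  proof (rule emeasure_le_of_dyadic_cells[OF l A(1) M])
    fix x m assume "x \<in> A"
    then have "\<not> P (dyadic_cell a l m x)" "x \<in> R"
      by (auto simp: A_def D_def Union_stopping_cells)
    moreover have "dyadic_cell a l m x \<subseteq> R"
      using dyadic_cell_antimono[of 0 m a l x] \<open>x \<in> R\<close> dyadic_cell_eq unfolding R_def by blast
    ultimately show "emeasure M (dyadic_cell a l m x) \<le> ennreal (2 * b) * emeasure lebesgue (dyadic_cell a l m x)"
      by (simp add: P_def not_less del: emeasure_completion)
  qed
  then have A_null: "emeasure lebesgue A = 0"
  proof (intro null_set_of_integral_le[OF A(1), where g = "\<lambda>x. \<bar>g x\<bar>" and c = "2 * b"])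
    show "emeasure lebesgue A < \<infinity>"
      by (rule le_less_trans[OF emeasure_mono[OF A(2) sets_cube[OF Q]]]) (simp add: emeasure_cube[OF Q] del: emeasure_completion)
    show "2 * b < \<bar>g x\<bar>" if "x \<in> A" for x
    proof -
      have "real (Suc k) * c < \<bar>F x\<bar>" "g x = F x"
        using that RQ by (auto simp: A_def E_def g_def)
      moreover have "1 * c \<le> real (Suc k) * c"
        using c by (intro mult_right_mono) auto
      ultimately show ?thesis
        using c by linarith
    qed
  qed (use b A in \<open>auto simp: M_def emeasure_density\<close>)

  have "emeasure lebesgue (\<Union>D) \<le> ennreal (1 / (2 * b)) * emeasure M (\<Union>D)"
  proof (rule emeasure_Union_disjoint_le[OF D])
    fix S assume "S \<in> D"
    then have "ennreal (2 * b) * emeasure lebesgue S \<le> emeasure M S"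
      using P_D by (simp add: P_def less_imp_le del: emeasure_completion)
    then have "ennreal (1 / (2 * b)) * (ennreal (2 * b) * emeasure lebesgue S) \<le> ennreal (1 / (2 * b)) * emeasure M S"
      by (intro mult_left_mono) auto
    then show "emeasure lebesgue S \<le> ennreal (1 / (2 * b)) * emeasure M S"
      using b by (simp add: mult.assoc[symmetric] ennreal_mult'[symmetric] del: emeasure_completion)
  qed (use D M in auto)
  also have "\<dots> \<le> ennreal (1 / (2 * b)) * (ennreal b * emeasure lebesgue Q)"
  proof (rule mult_left_mono)
    have "\<Union>D \<subseteq> Q"
      using P_D RQ by (auto simp: P_def)
    then show "emeasure M (\<Union>D) \<le> ennreal b * emeasure lebesgue Q"
      using emMQ by (intro order_trans[OF emeasure_mono emMQ]) (auto simp: M sets_cube[OF Q])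
  qed simp
  also have "\<dots> = ennreal (1 / 2) * emeasure lebesgue Q"
    using b by (simp add: mult.assoc[symmetric] ennreal_mult'[symmetric] del: emeasure_completion)
  finally have UD_le: "emeasure lebesgue (\<Union>D) \<le> ennreal (1 / 2) * emeasure lebesgue Q" .

  have "emeasure lebesgue E \<le> emeasure lebesgue ((E \<inter> \<Union>D) \<union> (A \<union> (Q - R)))"
  proof (rule emeasure_mono)
    show "E \<subseteq> (E \<inter> \<Union>D) \<union> (A \<union> (Q - R))"
      by (auto simp: A_def E_def)
    have "Q - R \<in> sets lebesgue"
      using sets_cube[OF Q] by (auto simp: R_def)
    then show "(E \<inter> \<Union>D) \<union> (A \<union> (Q - R)) \<in> sets lebesgue"
      using A(1) E UD by (intro sets.Un sets.Int)
  qed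
  also have "\<dots> = emeasure lebesgue (E \<inter> \<Union>D)"
    using A A_null QR by (intro emeasure_Un_null_set null_sets.Un) (auto simp: negligible_iff_null_sets null_setsI)
  \<comment> \<open>Restricting Lebesgue measure to E makes the bounds for the sets
    \<open>E \<inter> S\<close> an instance of the estimate for disjoint unions.\<close>
  also have "\<dots> = emeasure (density lebesgue (indicator E)) (\<Union>D)"
    by (simp add: emeasure_restricted)
  also have "\<dots> \<le> ennreal ((1 / 2) ^ k) * emeasure lebesgue (\<Union>D)"
    using D S_bound
    by (intro emeasure_Union_disjoint_le) (auto simp: emeasure_restricted subset_eq simp del: emeasure_completion)
  also have "\<dots> \<le> ennreal ((1 / 2) ^ k) * (ennreal (1 / 2) * emeasure lebesgue Q)"
    using UD_le by (intro mult_left_mono) auto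
  also have "\<dots> = ennreal ((1 / 2) ^ Suc k) * emeasure lebesgue Q"
    by (simp only: mult.assoc[symmetric] ennreal_mult'[symmetric] power_Suc2 zero_le_power zero_le_divide_1_iff zero_le_numeral)
  finally have "emeasure lebesgue E \<le> ennreal ((1 / 2) ^ Suc k) * emeasure lebesgue Q" .
  then show ?case
    by (simp add: E_def F_def c_def)
qed

section \<open>Sums of indicators of nested sets\<close>

lemma (in quasi_banach_function_space) ext_qnorm_mono:
  assumes "f \<in> borel_measurable (lebesgue_on Q)" "AE x in lebesgue_on Q. \<bar>f x\<bar> \<le> \<bar>g x\<bar>"
  shows "ext_qnorm V f \<le> ext_qnorm V g"
  using assms ideal[of g f] compatible[of f g] by (auto simp: ext_qnorm_def intro: ennreal_leI)

lemma (in quasi_banach_function_space) ext_qnorm_scale: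
  assumes "0 < c"
  shows "ext_qnorm V (\<lambda>x. c * f x) = ennreal c * ext_qnorm V f"
  using assms scale[of f c] scale[of "\<lambda>x. c * f x" "1 / c"] qnorm_scale[of f c] qnorm_nonneg[of f]
  by (auto simp: ext_qnorm_def ennreal_mult ennreal_mult_top)

lemma funs_if_ext_qnorm_finite: "ext_qnorm V f < \<infinity> \<Longrightarrow> f \<in> funs V"
  by (auto simp: ext_qnorm_def split: if_splits)

definition thin_chain :: "(real ^ 'n) set \<Rightarrow> (nat \<Rightarrow> (real ^ 'n) set) \<Rightarrow> bool" where
  "thin_chain Q \<Omega> \<longleftrightarrow> (\<forall>k. \<Omega> k \<in> sets lebesgue \<and> \<Omega> k \<subseteq> Q \<and> \<Omega> (Suc k) \<subseteq> \<Omega> k \<and>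
    measure lebesgue (\<Omega> k) \<le> (1 / 2) ^ k * measure lebesgue Q)"

lemma sum_indicators_eq:
  assumes "\<And>k. x \<in> \<Omega> k \<longleftrightarrow> k < N"
  shows "sum_indicators \<Omega> x = real N"
proof -
  have "sum_indicators \<Omega> x = (\<Sum>k<N. indicator (\<Omega> k) x)"
    unfolding sum_indicators_def using assms by (intro suminf_finite) auto
  also have "\<dots> = (\<Sum>k<N. 1)"
    using assms by (intro sum.cong) auto
  finally show ?thesis by simp
qed

text \<open>The first set that misses x decides all memberships. This turns the real
  \<open>suminf\<close> in \<open>sum_indicators\<close> into a finite count.\<close>

lemma nested_countingE:
  assumes "\<And>k. \<Omega> (Suc k) \<subseteq> \<Omega> k" "x \<notin> (\<Inter>k. \<Omega> k)"
  obtains N where "\<And>k. x \<in> \<Omega> k \<longleftrightarrow> k < N"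
proof
  have anti: "\<Omega> j \<subseteq> \<Omega> i" if "i \<le> j" for i j
    using lift_Suc_antimono_le[of \<Omega>, OF assms(1) that] .
  have ex: "\<exists>k. x \<notin> \<Omega> k"
    using assms(2) by auto
  show "x \<in> \<Omega> k \<longleftrightarrow> k < (LEAST k. x \<notin> \<Omega> k)" for k
    using LeastI_ex[OF ex] not_less_Least[of k "\<lambda>k. x \<notin> \<Omega> k"] anti[of "LEAST k. x \<notin> \<Omega> k" k]
    by (meson linorder_not_le subsetD)
qed

text \<open>The sum counts the naturals k strictly below \<open>|F x| / s\<close>, and their number
  is the ceiling of this quotient; the strict inequality in the sets is what yields the
  ceiling.\<close>

lemma abs_le_sum_indicators_superlevel:
  assumes "0 < s" "x \<in> Q"
  shows "\<bar>F x\<bar> \<le> s * sum_indicators (\<lambda>k. {x \<in> Q. real k * s < \<bar>F x\<bar>}) x"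
proof -
  define N where "N = nat \<lceil>\<bar>F x\<bar> / s\<rceil>"
  have "x \<in> {x \<in> Q. real k * s < \<bar>F x\<bar>} \<longleftrightarrow> k < N" for k
  proof -
    have "k < N \<longleftrightarrow> real k < \<bar>F x\<bar> / s"
      unfolding N_def by (metis less_ceiling_iff of_int_of_nat_eq zless_nat_eq_int_zless)
    then show ?thesis
      using assms by (simp add: field_simps)
  qed
  then have "sum_indicators (\<lambda>k. {x \<in> Q. real k * s < \<bar>F x\<bar>}) x = real N"
    by (rule sum_indicators_eq)
  moreover have "\<bar>F x\<bar> / s \<le> real N"
    unfolding N_def by linarith
  ultimately show ?thesis
    using assms by (simp add: field_simps)
qed

lemma borel_measurable_sum_indicators:
  assumes "thin_chain Q \<Omega>"
  shows "sum_indicators \<Omega> \<in> borel_measurable lebesgue"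
proof -
  have [measurable]: "\<Omega> k \<in> sets lebesgue" for k
    using assms by (simp add: thin_chain_def)
  show ?thesis
    unfolding sum_indicators_def[abs_def] by measurable
qed

lemma thin_chain_emeasure_le:
  assumes "thin_chain Q \<Omega>" "Q \<in> cubes"
  shows "emeasure lebesgue (\<Omega> k) \<le> ennreal ((1 / 2) ^ k * measure lebesgue Q)"
proof -
  have \<Omega>: "\<Omega> k \<in> sets lebesgue" "\<Omega> k \<subseteq> Q" "measure lebesgue (\<Omega> k) \<le> (1 / 2) ^ k * measure lebesgue Q"
    using assms by (auto simp: thin_chain_def)
  have "emeasure lebesgue (\<Omega> k) \<noteq> top"
    using emeasure_mono[OF \<Omega>(2) sets_cube[OF assms(2)]]
    by (auto simp: emeasure_cube[OF assms(2)] top_unique simp del: emeasure_completion)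
  then show ?thesis
    using \<Omega>(3) by (subst emeasure_eq_ennreal_measure) (auto intro: ennreal_leI simp del: emeasure_completion measure_completion)
qed

lemma thin_chain_Inter_null:
  assumes "thin_chain Q \<Omega>" "Q \<in> cubes"
  shows "AE x in lebesgue. x \<notin> (\<Inter>k. \<Omega> k)"
proof -
  have sets: "(\<Inter>k. \<Omega> k) \<in> sets lebesgue"
    using assms by (auto simp: thin_chain_def)
  have le: "emeasure lebesgue (\<Inter>k. \<Omega> k) \<le> ennreal ((1 / 2) ^ k * measure lebesgue Q)" for k
    using assms(1) by (intro order_trans[OF emeasure_mono thin_chain_emeasure_le[OF assms]]) (auto simp: thin_chain_def)
  have "(\<lambda>k. (1 / 2) ^ k * measure lebesgue Q) \<longlonglongrightarrow> 0"
    by (intro tendsto_mult_left_zero LIMSEQ_realpow_zero) auto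
  then have "(\<lambda>k. ennreal ((1 / 2) ^ k * measure lebesgue Q)) \<longlonglongrightarrow> ennreal 0"
    by (rule tendsto_ennrealI)
  then have "emeasure lebesgue (\<Inter>k. \<Omega> k) \<le> ennreal 0"
    using le by (intro LIMSEQ_le_const) auto
  then have "(\<Inter>k. \<Omega> k) \<in> null_sets lebesgue"
    using sets by (auto intro!: null_setsI simp del: emeasure_completion)
  then show ?thesis
    using AE_not_in by blast
qed

definition chain_bound :: "((real ^ 'n) set \<Rightarrow> (real ^ 'n) fspace) \<Rightarrow> real \<Rightarrow> bool" where
  "chain_bound X C \<longleftrightarrow>
    (\<forall>Q \<in> cubes. \<forall>\<Omega>. thin_chain Q \<Omega> \<longrightarrow> ext_qnorm (X Q) (sum_indicators \<Omega>) \<le> ennreal C)"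

text \<open>Linearity of the bound in s turns it into a norm inequality later: s is taken
  proportional to a bound for the BMO norm, or to an admissible \<alpha> in the exp L norm.\<close>

lemma ext_qnorm_le_of_superlevel_decay:
  fixes F :: "real ^ 'n \<Rightarrow> real"
  assumes "quasi_banach_function_space Q (X Q)" and C: "chain_bound X C" "0 < C" and Q: "Q \<in> cubes"
    and F: "F \<in> borel_measurable (lebesgue_on Q)" and "0 < s"
    and decay: "\<And>k. emeasure lebesgue {x \<in> Q. real k * s < \<bar>F x\<bar>} \<le> ennreal ((1 / 2) ^ k) * emeasure lebesgue Q"
  shows "ext_qnorm (X Q) F \<le> ennreal (C * s)"
proof -
  interpret quasi_banach_function_space Q "X Q" by fact
  define \<Omega> where "\<Omega> k = {x \<in> Q. real k * s < \<bar>F x\<bar>}" for k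
  have meas: "\<Omega> k \<in> sets lebesgue" for k
    unfolding \<Omega>_def using sets_cube_superlevel[OF Q F, of _ 0] by simp
  have "thin_chain Q \<Omega>"
    unfolding thin_chain_def
  proof (intro allI conjI meas)
    fix k
    show "\<Omega> k \<subseteq> Q"
      by (auto simp: \<Omega>_def)
    have "real k * s \<le> real (Suc k) * s"
      using \<open>0 < s\<close> by (intro mult_right_mono) auto
    then show "\<Omega> (Suc k) \<subseteq> \<Omega> k"
      by (auto simp: \<Omega>_def)
    have "emeasure lebesgue (\<Omega> k) \<le> ennreal ((1 / 2) ^ k * measure lebesgue Q)"
      using decay[of k] by (simp add: \<Omega>_def ennreal_mult' emeasure_cube[OF Q] del: emeasure_completion)
    then show "measure lebesgue (\<Omega> k) \<le> (1 / 2) ^ k * measure lebesgue Q"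
      unfolding measure_def[of _ "\<Omega> k"] by (intro enn2real_leI) simp_all
  qed
  then have "ext_qnorm (X Q) (sum_indicators \<Omega>) \<le> ennreal C"
    using C(1) Q by (simp add: chain_bound_def)
  have "ext_qnorm (X Q) F \<le> ext_qnorm (X Q) (\<lambda>x. s * sum_indicators \<Omega> x)"
  proof (rule ext_qnorm_mono[OF F AE_I2])
    fix x assume "x \<in> space (lebesgue_on Q)"
    then have "\<bar>F x\<bar> \<le> s * sum_indicators \<Omega> x"
      unfolding \<Omega>_def[abs_def] using \<open>0 < s\<close> by (intro abs_le_sum_indicators_superlevel) auto
    then show "\<bar>F x\<bar> \<le> \<bar>s * sum_indicators \<Omega> x\<bar>"
      by linarith
  qed
  also have "\<dots> = ennreal s * ext_qnorm (X Q) (sum_indicators \<Omega>)"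
    using \<open>0 < s\<close> by (rule ext_qnorm_scale)
  also have "\<dots> \<le> ennreal s * ennreal C"
    by (intro mult_left_mono) (use \<open>ext_qnorm (X Q) (sum_indicators \<Omega>) \<le> ennreal C\<close> in auto)
  finally show ?thesis
    using \<open>0 < s\<close> \<open>0 < C\<close> by (simp add: ennreal_mult[symmetric] mult.commute)
qed

section \<open>The chain bound and the two embeddings\<close>

lemma BMO_average_le:
  assumes "bmo_norm f \<le> ennreal b" "0 \<le> b" "Q \<in> cubes"
  shows "average Q (\<lambda>x. \<bar>f x - average Q f\<bar>) \<le> b"
proof -
  have "ennreal (average Q (\<lambda>x. \<bar>f x - average Q f\<bar>)) \<le> ennreal b"
    using assms(1,3) unfolding bmo_norm_def SUP_le_iff by blast
  then show ?thesis
    using assms(2) by (simp add: ennreal_le_iff)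
qed

proposition chain_bound_imp_BMO_embedding:
  fixes X :: "(real ^ 'n) set \<Rightarrow> (real ^ 'n) fspace"
  assumes X: "\<And>Q. Q \<in> cubes \<Longrightarrow> quasi_banach_function_space Q (X Q)"
    and C: "chain_bound X C" "0 < C" and f: "f \<in> BMO"
  shows "f \<in> BMO_on X \<and> bmo_norm_on X f \<le> ennreal (C * 2 ^ (CARD('n) + 1)) * bmo_norm f"
proof -
  define c :: real where "c = 2 ^ (CARD('n) + 1)"
  define K where "K = C * c"
  have "0 < c" by (simp add: c_def)
  then have "0 < K" using C by (simp add: K_def)
  have loc: "locally_integrable f"
    using f by (simp add: BMO_def)
  obtain t where t: "bmo_norm f = ennreal t" "0 \<le> t"
    using f by (cases "bmo_norm f") (auto simp: BMO_def)
  \<comment> \<open>A strict upper bound b of t is positive, as John-Nirenberg requires, even if the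
    BMO norm of f is 0. Afterwards b tends to t.\<close>
  have *: "bmo_norm_on X f \<le> ennreal (K * b)" if "t < b" for b
    unfolding bmo_norm_on_def
  proof (rule SUP_least)
    fix Q :: "(real ^ 'n) set" assume Q: "Q \<in> cubes"
    have "0 < b" "bmo_norm f \<le> ennreal b"
      using that t by (auto intro: ennreal_leI)
    then have avg: "average S (\<lambda>x. \<bar>f x - average S f\<bar>) \<le> b" if "S \<in> cubes" for S
      using BMO_average_le that by (metis less_imp_le)
    have "ext_qnorm (X Q) (\<lambda>x. f x - average Q f) \<le> ennreal (C * (c * b))"
    proof (rule ext_qnorm_le_of_superlevel_decay[OF X[OF Q] C Q])
      show "(\<lambda>x. f x - average Q f) \<in> borel_measurable (lebesgue_on Q)"
        using integrable_on_cube[OF loc Q] by auto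
      show "emeasure lebesgue {x \<in> Q. real k * (c * b) < \<bar>f x - average Q f\<bar>}
          \<le> ennreal ((1 / 2) ^ k) * emeasure lebesgue Q" for k
        unfolding c_def using John_Nirenberg[OF loc \<open>0 < b\<close> avg Q] .
    qed (use \<open>0 < b\<close> \<open>0 < c\<close> in auto)
    then show "ext_qnorm (X Q) (\<lambda>x. f x - average Q f) \<le> ennreal (K * b)"
      by (simp add: K_def mult.assoc)
  qed
  have "bmo_norm_on X f \<le> ennreal (K * t)"
  proof (rule ennreal_le_epsilon)
    fix e :: real assume "0 < e"
    then have "bmo_norm_on X f \<le> ennreal (K * (t + e / K))"
      using \<open>0 < K\<close> by (intro *) auto
    also have "K * (t + e / K) = K * t + e"
      using \<open>0 < K\<close> by (simp add: field_simps)
    finally show "bmo_norm_on X f \<le> ennreal (K * t) + ennreal e"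
      using \<open>0 < K\<close> \<open>0 < e\<close> t(2) by simp
  qed
  moreover have "ennreal (K * t) = ennreal K * bmo_norm f"
    using t \<open>0 < K\<close> by (simp add: ennreal_mult)
  moreover have "bmo_norm_on X f < \<infinity>"
    by (rule le_less_trans[OF calculation(1)]) simp
  ultimately show ?thesis
    using loc by (simp add: BMO_on_def K_def c_def)
qed

proposition chain_bound_imp_expL_embedding:
  fixes X :: "(real ^ 'n) set \<Rightarrow> (real ^ 'n) fspace"
  assumes X: "quasi_banach_function_space Q (X Q)"
    and C: "chain_bound X C" "0 < C" and Q: "Q \<in> cubes" and f: "f \<in> expL Q"
  shows "f \<in> funs (X Q) \<and> ext_qnorm (X Q) f \<le> ennreal (C * ln 3) * expL_norm Q f"
proof -
  have f_meas: "f \<in> borel_measurable (lebesgue_on Q)"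
    using f by (simp add: expL_def)
  have ln3: "0 < C * ln 3"
    using C by simp
  let ?I = "\<lambda>\<alpha>. \<integral>\<^sup>+x. ennreal (exp (\<bar>f x\<bar> / \<alpha>) - 1) \<partial>lebesgue_on Q"
  have *: "ext_qnorm (X Q) f \<le> ennreal (C * ln 3) * ennreal \<alpha>"
    if \<alpha>: "0 < \<alpha>" "?I \<alpha> / emeasure lebesgue Q \<le> 1" for \<alpha>
  proof -
    have I_le: "?I \<alpha> \<le> emeasure lebesgue Q"
    proof -
      have "?I \<alpha> = emeasure lebesgue Q * ?I \<alpha> / emeasure lebesgue Q"
        using measure_cube_pos[OF Q]
        by (subst mult.commute, subst ennreal_mult_divide_eq) (auto simp: emeasure_cube[OF Q] simp del: emeasure_completion measure_completion)
      also have "\<dots> = ?I \<alpha> / emeasure lebesgue Q * emeasure lebesgue Q"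
        by (simp only: ennreal_times_divide[symmetric] mult.commute)
      also have "\<dots> \<le> 1 * emeasure lebesgue Q"
        using \<alpha>(2) by (rule mult_right_mono) simp
      finally show ?thesis by simp
    qed
    \<comment> \<open>At the k-th level the exponential is at least 3^k, and subtracting 1 still
      leaves 2^k. Steps of length \<open>\<alpha> * ln 2\<close> would leave only
      \<open>2 ^ k - 1\<close>.\<close>
    have "ext_qnorm (X Q) f \<le> ennreal (C * (\<alpha> * ln 3))"
    proof (rule ext_qnorm_le_of_superlevel_decay[where X = X, OF X C Q f_meas])
      fix k
      let ?S = "{x \<in> Q. real k * (\<alpha> * ln 3) < \<bar>f x\<bar>}"
      have S: "?S \<in> sets lebesgue"
        using sets_cube_superlevel[OF Q f_meas, of _ 0] by simp
      show "emeasure lebesgue ?S \<le> ennreal ((1 / 2) ^ k) * emeasure lebesgue Q"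
      proof (cases k)
        \<comment> \<open>Here \<open>3 ^ k - 1\<close> vanishes and Markov's inequality says
          nothing; inclusion in Q is enough.\<close>
        case 0
        then show ?thesis
          using sets_cube[OF Q] by (auto intro!: emeasure_mono simp del: emeasure_completion)
      next
        case (Suc j)
        have pow: "(2 :: real) ^ k \<le> 3 ^ k - 1"
          unfolding Suc
        proof (induction j)
          case (Suc i)
          moreover have "(1 :: real) \<le> 3 ^ i"
            by simp
          ultimately show ?case
            unfolding power_Suc by linarith
        qed simp
        have "ennreal (2 ^ k) * emeasure lebesgue ?S = ennreal (2 ^ k) * emeasure (lebesgue_on Q) ?S"
          using sets_cube[OF Q] by (subst emeasure_restrict_space) auto
        also have "\<dots> = (\<integral>\<^sup>+x. ennreal (2 ^ k) * indicator ?S x \<partial>lebesgue_on Q)"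
          using S sets_cube[OF Q] by (intro nn_integral_cmult_indicator[symmetric]) (auto simp: sets_restrict_space_iff)
        also have "\<dots> \<le> ?I \<alpha>"
        proof (rule nn_integral_mono)
          fix x
          have "2 ^ k \<le> exp (\<bar>f x\<bar> / \<alpha>) - 1" if "real k * (\<alpha> * ln 3) < \<bar>f x\<bar>"
          proof -
            have "real k * ln 3 \<le> \<bar>f x\<bar> / \<alpha>"
              using that \<alpha>(1) by (simp add: field_simps)
            then have "exp (real k * ln 3) \<le> exp (\<bar>f x\<bar> / \<alpha>)"
              by simp
            moreover have "exp (real k * ln 3) = (3 :: real) ^ k"
              by (simp add: exp_of_nat_mult)
            ultimately show ?thesis
              using pow by linarith
          qed
          then show "ennreal (2 ^ k) * indicator ?S x \<le> ennreal (exp (\<bar>f x\<bar> / \<alpha>) - 1)"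
            by (auto simp: indicator_def intro: ennreal_leI)
        qed
        finally have "ennreal (2 ^ k) * emeasure lebesgue ?S \<le> emeasure lebesgue Q"
          using I_le by (rule order_trans)
        then have "ennreal ((1 / 2) ^ k) * (ennreal (2 ^ k) * emeasure lebesgue ?S) \<le> ennreal ((1 / 2) ^ k) * emeasure lebesgue Q"
          by (intro mult_left_mono) auto
        moreover have "ennreal ((1 / 2) ^ k) * ennreal (2 ^ k) = 1"
          by (subst ennreal_mult'[symmetric]) (auto simp: power_mult_distrib[symmetric])
        ultimately show ?thesis
          by (simp add: mult.assoc[symmetric] del: emeasure_completion)
      qed
    qed (use \<alpha> in auto)
    then show ?thesis
      using \<alpha> ln3 by (simp add: ennreal_mult''[symmetric] mult_ac)
  qed
  \<comment> \<open>With the constant divided out, the bound for each admissible \<alpha> passes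
    directly to the infimum.\<close>
  have "ext_qnorm (X Q) f / ennreal (C * ln 3) \<le> expL_norm Q f"
    unfolding expL_norm_def
  proof (rule INF_greatest)
    fix \<alpha> assume "\<alpha> \<in> {\<alpha>. 0 < \<alpha> \<and> ?I \<alpha> / emeasure lebesgue Q \<le> 1}"
    then show "ext_qnorm (X Q) f / ennreal (C * ln 3) \<le> ennreal \<alpha>"
      using * ln3 by (intro divide_le_posI_ennreal) auto
  qed
  then have le: "ext_qnorm (X Q) f \<le> ennreal (C * ln 3) * expL_norm Q f"
  proof -
    assume "ext_qnorm (X Q) f / ennreal (C * ln 3) \<le> expL_norm Q f"
    then have "ennreal (C * ln 3) * (ext_qnorm (X Q) f / ennreal (C * ln 3)) \<le> ennreal (C * ln 3) * expL_norm Q f"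
      by (intro mult_left_mono) auto
    moreover have "ennreal (C * ln 3) * (ext_qnorm (X Q) f / ennreal (C * ln 3)) = ext_qnorm (X Q) f"
      using ln3 by (subst ennreal_times_divide, subst mult.commute, subst ennreal_mult_divide_eq) auto
    ultimately show ?thesis by simp
  qed
  have "expL_norm Q f < \<infinity>"
    using f by (simp add: expL_def)
  then have "ext_qnorm (X Q) f < \<infinity>"
    using le by (auto simp: ennreal_mult_less_top intro: le_less_trans)
  then show ?thesis
    using le funs_if_ext_qnorm_finite by blast
qed

proposition expL_embedding_imp_chain_bound:
  fixes X :: "(real ^ 'n) set \<Rightarrow> (real ^ 'n) fspace"
  assumes C: "0 < C" "\<And>Q f. Q \<in> cubes \<Longrightarrow> f \<in> expL Q \<Longrightarrow> ext_qnorm (X Q) f \<le> ennreal C * expL_norm Q f"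
  shows "chain_bound X (C / ln (4 / 3))"
  unfolding chain_bound_def
proof (intro ballI allI impI)
  fix Q :: "(real ^ 'n) set" and \<Omega> assume Q: "Q \<in> cubes" and \<Omega>: "thin_chain Q \<Omega>"
  \<comment> \<open>4/3 is the base b with \<open>(b - 1) * (\<Sum>k. (b / 2) ^ k) = 1\<close>, so
    the bound for the exponential integral comes out as exactly |Q|, the normalization in the exp L
    norm.\<close>
  define L :: real where "L = ln (4 / 3)"
  have "0 < L" by (simp add: L_def)
  define S where "S = sum_indicators \<Omega>"
  have \<Omega>_sets [measurable]: "\<Omega> k \<in> sets (lebesgue_on Q)" for k
    using \<Omega> sets_cube[OF Q] by (auto simp: thin_chain_def sets_restrict_space_iff)
  have em: "emeasure (lebesgue_on Q) (\<Omega> k) \<le> ennreal ((1 / 2) ^ k * measure lebesgue Q)" for k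
    using thin_chain_emeasure_le[OF \<Omega> Q, of k] \<Omega> sets_cube[OF Q]
    by (subst emeasure_restrict_space) (auto simp: thin_chain_def simp del: emeasure_completion measure_completion)
  have S_meas: "S \<in> borel_measurable (lebesgue_on Q)"
    unfolding S_def by (intro measurable_restrict_space1 borel_measurable_sum_indicators[OF \<Omega>])
  have null: "AE x in lebesgue_on Q. x \<notin> (\<Inter>k. \<Omega> k)"
    using thin_chain_Inter_null[OF \<Omega> Q] sets_cube[OF Q] by (subst AE_restrict_space_iff) auto
  have "(\<integral>\<^sup>+x. ennreal (exp (\<bar>S x\<bar> / (1 / L)) - 1) \<partial>lebesgue_on Q)
      \<le> (\<integral>\<^sup>+x. (\<Sum>k. ennreal ((4 / 3) ^ k / 3) * indicator (\<Omega> k) x) \<partial>lebesgue_on Q)"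
  proof (rule nn_integral_mono_AE, use null in eventually_elim)
    fix x assume "x \<notin> (\<Inter>k. \<Omega> k)"
    moreover have "\<Omega> (Suc k) \<subseteq> \<Omega> k" for k
      using \<Omega> by (simp add: thin_chain_def)
    ultimately obtain N where N: "\<And>k. x \<in> \<Omega> k \<longleftrightarrow> k < N"
      using nested_countingE[of \<Omega> x] by blast
    then have "S x = real N"
      unfolding S_def by (rule sum_indicators_eq)
    then have "exp (\<bar>S x\<bar> / (1 / L)) - 1 = (4 / 3) ^ N - 1"
      by (simp add: exp_of_nat_mult L_def)
    \<comment> \<open>Telescoping: the increments of the powers of 4/3 are
      \<open>(4 / 3) ^ k / 3\<close>. Written as a sum over the sets containing x, the exponential
      can be integrated term by term.\<close>
    also have "\<dots> = (\<Sum>k<N. (4 / 3) ^ k / 3)"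
      by (induction N) (auto simp: field_simps)
    also have "ennreal \<dots> = (\<Sum>k<N. ennreal ((4 / 3) ^ k / 3) * indicator (\<Omega> k) x)"
      using N by (subst sum_ennreal[symmetric]) auto
    also have "\<dots> \<le> (\<Sum>k. ennreal ((4 / 3) ^ k / 3) * indicator (\<Omega> k) x)"
      by (rule sum_le_suminf) auto
    finally show "ennreal (exp (\<bar>S x\<bar> / (1 / L)) - 1) \<le> (\<Sum>k. ennreal ((4 / 3) ^ k / 3) * indicator (\<Omega> k) x)" .
  qed
  also have "\<dots> = (\<Sum>k. ennreal ((4 / 3) ^ k / 3) * emeasure (lebesgue_on Q) (\<Omega> k))"
    by (subst nn_integral_suminf) (auto simp: nn_integral_cmult_indicator)
  also have "\<dots> \<le> (\<Sum>k. ennreal ((4 / 3) ^ k / 3) * ennreal ((1 / 2) ^ k * measure lebesgue Q))"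
    by (intro suminf_le mult_left_mono em) auto
  also have "\<dots> = (\<Sum>k. ennreal ((2 / 3) ^ k * (measure lebesgue Q / 3)))"
    by (intro suminf_cong, subst ennreal_mult'[symmetric])
       (auto simp: power_mult_distrib[symmetric] mult.assoc[symmetric] simp del: measure_completion)
  also have "\<dots> = ennreal (1 / (1 - 2 / 3) * (measure lebesgue Q / 3))"
    by (intro suminf_ennreal_eq sums_mult2 geometric_sums) auto
  also have "\<dots> = emeasure lebesgue Q"
    by (simp add: emeasure_cube[OF Q] del: emeasure_completion measure_completion)
  finally have int_le: "(\<integral>\<^sup>+x. ennreal (exp (\<bar>S x\<bar> / (1 / L)) - 1) \<partial>lebesgue_on Q) \<le> emeasure lebesgue Q" .
  have "expL_norm Q S \<le> ennreal (1 / L)"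
    unfolding expL_norm_def
  proof (rule INF_lower, intro CollectI conjI)
    show "0 < 1 / L" using \<open>0 < L\<close> by simp
    have "(\<integral>\<^sup>+x. ennreal (exp (\<bar>S x\<bar> / (1 / L)) - 1) \<partial>lebesgue_on Q) / emeasure lebesgue Q
        \<le> emeasure lebesgue Q / emeasure lebesgue Q"
      using int_le by (rule divide_right_mono_ennreal)
    also have "\<dots> = 1"
      using measure_cube_pos[OF Q] by (simp add: emeasure_cube[OF Q] del: emeasure_completion measure_completion)
    finally show "(\<integral>\<^sup>+x. ennreal (exp (\<bar>S x\<bar> / (1 / L)) - 1) \<partial>lebesgue_on Q) / emeasure lebesgue Q \<le> 1" .
  qed
  moreover from this have "S \<in> expL Q"
    using S_meas by (auto simp: expL_def intro: le_less_trans)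
  ultimately have "ext_qnorm (X Q) S \<le> ennreal C * ennreal (1 / L)"
    using C(2)[OF Q, of S] by (meson mult_left_mono order_trans zero_le)
  also have "\<dots> = ennreal (C / L)"
    using C(1) \<open>0 < L\<close> by (simp add: ennreal_mult'[symmetric])
  finally show "ext_qnorm (X Q) (sum_indicators \<Omega>) \<le> ennreal (C / ln (4 / 3))"
    by (simp add: S_def L_def)
qed

section \<open>The maximal function of a finite measure\<close>

text \<open>Uncentred, so that superlevel sets are unions of open balls, and so that one ball tests
  the function at all of its points. Balls of nonpositive radius are empty and never
  contribute.\<close>

definition maximal_function :: "'a :: euclidean_space measure \<Rightarrow> 'a \<Rightarrow> ennreal" where
  "maximal_function M x =
    (SUP (c, r) \<in> {(c, r). x \<in> ball c r}. emeasure M (ball c r) / emeasure lborel (ball c r))"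

lemma less_maximal_function_iff:
  "t < maximal_function M x \<longleftrightarrow> (\<exists>c r. x \<in> ball c r \<and> t < emeasure M (ball c r) / emeasure lborel (ball c r))"
  unfolding maximal_function_def less_SUP_iff by auto

lemma emeasure_lborel_ball_eq: "emeasure lborel (ball c r) = ennreal (measure lborel (ball c r))"
  using emeasure_bounded_finite[OF bounded_ball, of c r] by (intro emeasure_eq_ennreal_measure) (simp add: less_top)

lemma emeasure_ball_scale:
  fixes c d :: "'a :: euclidean_space"
  assumes "0 \<le> k" "0 \<le> r"
  shows "emeasure lborel (ball c (k * r)) = ennreal (k ^ DIM('a)) * emeasure lborel (ball d r)"
  using assms by (simp add: emeasure_ball ennreal_mult[symmetric] power_mult_distrib mult_ac)

lemma less_ennreal_divide_ball:
  assumes "0 < r"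
  shows "t < a / emeasure lborel (ball c r) \<longleftrightarrow> t * emeasure lborel (ball c r) < a"
proof -
  have "0 < measure lborel (ball c r)" using assms by simp
  then show ?thesis
    unfolding emeasure_lborel_ball_eq
    by (cases a; cases t)
       (auto simp: divide_ennreal ennreal_mult[symmetric] ennreal_less_iff field_simps ennreal_top_mult ennreal_top_divide)
qed

lemma emeasure_ball_le_maximal_function:
  assumes "x \<in> ball c r"
  shows "emeasure M (ball c r) \<le> maximal_function M x * emeasure lborel (ball c r)"
proof (rule ccontr)
  have "0 < r"
    using assms by (metis ball_eq_empty empty_iff not_less)
  assume "\<not> ?thesis"
  then have "maximal_function M x < emeasure M (ball c r) / emeasure lborel (ball c r)"
    using \<open>0 < r\<close> by (simp add: less_ennreal_divide_ball not_le)
  then have "maximal_function M x < maximal_function M x"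
    using assms less_maximal_function_iff by blast
  then show False by simp
qed

lemma open_maximal_function_superlevel: "open {x. t < maximal_function M x}"
proof -
  have "{x. t < maximal_function M x} =
      \<Union> {ball c r | c r. t < emeasure M (ball c r) / emeasure lborel (ball c r)}"
    unfolding less_maximal_function_iff by blast
  also have "open \<dots>" by (rule open_Union) auto
  finally show ?thesis .
qed

lemma borel_measurable_maximal_function [measurable]: "maximal_function M \<in> borel_measurable borel"
  by (rule borel_measurableI_greater) (simp add: borel_open open_maximal_function_superlevel)

lemma emeasure_UN_le_nn_integral:
  assumes "countable C" "\<And>i. i \<in> C \<Longrightarrow> A i \<in> sets M"
  shows "emeasure M (\<Union>i\<in>C. A i) \<le> (\<integral>\<^sup>+i. emeasure M (A i) \<partial>count_space C)"
proof -
  have "emeasure M (\<Union>i\<in>C. A i) = (\<integral>\<^sup>+x. indicator (\<Union>i\<in>C. A i) x \<partial>M)"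
    using assms by (intro nn_integral_indicator[symmetric]) auto
  also have "\<dots> \<le> (\<integral>\<^sup>+x. (\<integral>\<^sup>+i. indicator (A i) x \<partial>count_space C) \<partial>M)"
  proof (rule nn_integral_mono)
    fix x
    show "indicator (\<Union>i\<in>C. A i) x \<le> (\<integral>\<^sup>+i. indicator (A i) x \<partial>count_space C :: ennreal)"
    proof (cases "x \<in> (\<Union>i\<in>C. A i)")
      case True
      then obtain i where "i \<in> C" "x \<in> A i" by auto
      then show ?thesis
        using nn_integral_ge_point[of i C "\<lambda>i. indicator (A i) x"] True by auto
    qed simp
  qed
  also have "\<dots> = (\<integral>\<^sup>+i. (\<integral>\<^sup>+x. indicator (A i) x \<partial>M) \<partial>count_space C)"
    using assms by (intro nn_integral_count_space_nn_integral) auto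
  also have "\<dots> = (\<integral>\<^sup>+i. emeasure M (A i) \<partial>count_space C)"
    using assms by (intro nn_integral_cong) auto
  finally show ?thesis .
qed

text \<open>Vitali covering: the balls of density above t have bounded radii because M is finite, so
  a countable disjoint subfamily covers the superlevel set after enlargement by the factor
  5.\<close>

lemma maximal_function_weak_type:
  fixes M :: "'a :: euclidean_space measure"
  assumes M: "finite_measure M" "sets M = sets borel" and "0 < t"
  shows "ennreal t * emeasure lborel {x. ennreal t < maximal_function M x} \<le> ennreal (5 ^ DIM('a)) * emeasure M UNIV"
proof -
  interpret finite_measure M by fact
  define K where "K = {(c, r). 0 < r \<and> ennreal t * emeasure lborel (ball c r) < emeasure M (ball c r)}"
  define V where "V = measure lborel (ball (0 :: 'a) 1)"
  have "0 < V" by (simp add: V_def)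
  have UNIV_M: "space M = UNIV"
    using M(2) sets_eq_imp_space_eq by fastforce
  \<comment> \<open>A radius r of at least 1 is bounded by its power with exponent
    \<open>DIM('a)\<close>, which the total mass controls; smaller radii account for the 1 in the
    maximum.\<close>
  have radius: "0 < snd i \<and> snd i \<le> max 1 (measure M UNIV / (t * V))" if i_K: "i \<in> K" for i
  proof -
    obtain c r where i: "i = (c, r)" "0 < r" "ennreal t * emeasure lborel (ball c r) < emeasure M (ball c r)"
      using i_K by (auto simp: K_def)
    have "ennreal t * emeasure lborel (ball c r) < emeasure M UNIV"
      using M(2) by (intro less_le_trans[OF i(3)] emeasure_mono) auto
    also have "emeasure lborel (ball c r) = ennreal (r ^ DIM('a) * V)"
      using emeasure_ball_scale[of r 1 c 0] i(2) by (simp add: emeasure_lborel_ball_eq V_def ennreal_mult)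
    finally have "t * (r ^ DIM('a) * V) < measure M UNIV"
      using \<open>0 < t\<close> \<open>0 < r\<close> \<open>0 < V\<close> by (simp add: emeasure_eq_measure ennreal_mult'[symmetric] ennreal_less_iff)
    then have "r ^ DIM('a) < measure M UNIV / (t * V)"
      using \<open>0 < t\<close> \<open>0 < V\<close> by (simp add: field_simps)
    moreover have "r \<le> r ^ DIM('a)" if "1 \<le> r"
      using that by (simp add: self_le_power)
    ultimately have "r \<le> max 1 (measure M UNIV / (t * V))"
      by linarith
    then show ?thesis using i by simp
  qed
  have cover: "{x. ennreal t < maximal_function M x} \<subseteq> (\<Union>i\<in>K. cball (fst i) (snd i))"
  proof
    fix x assume "x \<in> {x. ennreal t < maximal_function M x}"
    then obtain c r where cr: "x \<in> ball c r" "ennreal t < emeasure M (ball c r) / emeasure lborel (ball c r)"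
      by (auto simp: less_maximal_function_iff)
    moreover have "0 < r"
      using cr(1) by (metis ball_eq_empty empty_iff not_less)
    ultimately have "(c, r) \<in> K" "x \<in> cball c r"
      by (auto simp: K_def less_ennreal_divide_ball)
    then show "x \<in> (\<Union>i\<in>K. cball (fst i) (snd i))"
      by force
  qed
  obtain C where C: "countable C" "C \<subseteq> K"
    and disj: "pairwise (\<lambda>i j. disjnt (cball (fst i) (snd i)) (cball (fst j) (snd j))) C"
    and sub: "{x. ennreal t < maximal_function M x} \<subseteq> (\<Union>i\<in>C. cball (fst i) (5 * snd i))"
    using Vitali_covering_lemma_cballs[OF cover radius] by blast
  have CK: "0 < snd i" "ennreal t * emeasure lborel (ball (fst i) (snd i)) \<le> emeasure M (ball (fst i) (snd i))" if "i \<in> C" for i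
    using that C(2) by (auto simp: K_def)
  have "emeasure lborel {x. ennreal t < maximal_function M x} \<le> emeasure lborel (\<Union>i\<in>C. cball (fst i) (5 * snd i))"
    using sub C by (intro emeasure_mono) auto
  also have "\<dots> \<le> (\<integral>\<^sup>+i. emeasure lborel (cball (fst i) (5 * snd i)) \<partial>count_space C)"
    using C by (intro emeasure_UN_le_nn_integral) auto
  also have "\<dots> = (\<integral>\<^sup>+i. ennreal (5 ^ DIM('a)) * emeasure lborel (ball (fst i) (snd i)) \<partial>count_space C)"
  proof (rule nn_integral_cong)
    fix i assume "i \<in> space (count_space C)"
    then show "emeasure lborel (cball (fst i) (5 * snd i)) = ennreal (5 ^ DIM('a)) * emeasure lborel (ball (fst i) (snd i))"
      using CK(1)[of i] emeasure_ball_scale[of 5 "snd i" "fst i" "fst i"] by (simp add: emeasure_cball emeasure_ball)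
  qed
  finally have "ennreal t * emeasure lborel {x. ennreal t < maximal_function M x}
      \<le> ennreal t * (\<integral>\<^sup>+i. ennreal (5 ^ DIM('a)) * emeasure lborel (ball (fst i) (snd i)) \<partial>count_space C)"
    by (intro mult_left_mono) auto
  also have "\<dots> = ennreal (5 ^ DIM('a)) * (\<integral>\<^sup>+i. ennreal t * emeasure lborel (ball (fst i) (snd i)) \<partial>count_space C)"
    by (simp add: nn_integral_cmult mult.left_commute)
  also have "\<dots> \<le> ennreal (5 ^ DIM('a)) * (\<integral>\<^sup>+i. emeasure M (ball (fst i) (snd i)) \<partial>count_space C)"
    using CK(2) by (intro mult_left_mono nn_integral_mono) auto
  also have "(\<integral>\<^sup>+i. emeasure M (ball (fst i) (snd i)) \<partial>count_space C) = emeasure M (\<Union>i\<in>C. ball (fst i) (snd i))"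
  proof (rule emeasure_UN_countable[symmetric])
    show "disjoint_family_on (\<lambda>i. ball (fst i) (snd i)) C"
      using disj ball_subset_cball unfolding disjoint_family_on_def pairwise_def disjnt_def by blast
  qed (use C M in auto)
  also have "\<dots> \<le> emeasure M UNIV"
    using M by (intro emeasure_mono) auto
  finally show ?thesis
    by (simp add: mult_left_mono)
qed

text \<open>A real number is at most the number of naturals below it, so the sum of the superlevel
  measures, dominated by a geometric series, bounds the integral. Negative values of v are cut off
  by \<open>ennreal\<close>.\<close>

lemma nn_integral_le_of_superlevel_decay:
  assumes A: "A \<in> sets M" and v: "v \<in> borel_measurable M" and q: "0 \<le> q" "q < 1"
    and decay: "\<And>k. emeasure M {x \<in> A. real k < v x} \<le> ennreal (q ^ k) * c"
  shows "(\<integral>\<^sup>+x. ennreal (v x) * indicator A x \<partial>M) \<le> ennreal (1 / (1 - q)) * c"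
proof -
  have sets: "{x \<in> A. real k < v x} \<in> sets M" for k
  proof -
    have "{x \<in> A. real k < v x} = A \<inter> {x \<in> space M. real k < v x}"
      using sets.sets_into_space[OF A] by auto
    then show ?thesis using A v by auto
  qed
  have "(\<integral>\<^sup>+x. ennreal (v x) * indicator A x \<partial>M) \<le> (\<integral>\<^sup>+x. (\<Sum>k. indicator {x \<in> A. real k < v x} x) \<partial>M)"
  proof (rule nn_integral_mono)
    fix x
    define N where "N = nat \<lceil>v x\<rceil>"
    show "ennreal (v x) * indicator A x \<le> (\<Sum>k. indicator {x \<in> A. real k < v x} x)"
    proof (cases "x \<in> A")
      case True
      have "real k < v x" if "k < N" for k
        using that unfolding N_def by (simp add: zless_nat_eq_int_zless less_ceiling_iff)
      then have "(\<Sum>k<N. indicator {x \<in> A. real k < v x} x) = (\<Sum>k<N. 1 :: ennreal)"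
        using True by (intro sum.cong) auto
      moreover have "ennreal (v x) \<le> ennreal (real N)"
        unfolding N_def by (intro ennreal_leI) linarith
      ultimately have "ennreal (v x) \<le> (\<Sum>k<N. indicator {x \<in> A. real k < v x} x)"
        by (simp add: ennreal_of_nat_eq_real_of_nat)
      also have "\<dots> \<le> (\<Sum>k. indicator {x \<in> A. real k < v x} x)"
        by (rule sum_le_suminf) auto
      finally show ?thesis using True by simp
    qed simp
  qed
  also have "\<dots> = (\<Sum>k. emeasure M {x \<in> A. real k < v x})"
    using sets by (subst nn_integral_suminf) auto
  also have "\<dots> \<le> (\<Sum>k. ennreal (q ^ k) * c)"
    by (intro suminf_le decay) auto
  also have "\<dots> = (\<Sum>k. ennreal (q ^ k)) * c"
    by (rule ennreal_suminf_multc)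
  also have "(\<Sum>k. ennreal (q ^ k)) = ennreal (1 / (1 - q))"
    using q by (intro suminf_ennreal_eq geometric_sums) auto
  finally show ?thesis .
qed

section \<open>Superlevel sets of the maximal function on a cube\<close>

lemma dist_le_in_cube:
  fixes a :: "real ^ 'n"
  assumes "x \<in> cbox a (a + (\<chi> i. l))" "y \<in> cbox a (a + (\<chi> i. l))"
  shows "dist x y \<le> real CARD('n) * l"
proof -
  have "\<bar>(x - y) $ i\<bar> \<le> l" for i
    using assms by (auto simp: mem_box_cart abs_le_iff algebra_simps dest!: spec[of _ i])
  then have "norm (x - y) \<le> (\<Sum>i\<in>(UNIV :: 'n set). l)"
    by (intro order_trans[OF norm_le_l1_cart] sum_mono) auto
  then show ?thesis by (simp add: dist_norm)
qed

text \<open>The first term makes the superlevel bound trivial for \<open>t < 2 ^ CARD('n)\<close>.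
  The second combines the factor 5 per dimension of the weak-type inequality with the volume of a
  ball of radius \<open>3 * CARD('n)\<close> times the side of the cube.\<close>

definition maximal_const :: "'n :: finite itself \<Rightarrow> real" where
  "maximal_const _ = 2 ^ CARD('n) + (15 * real CARD('n)) ^ CARD('n) * measure lborel (ball (0 :: real ^ 'n) 1)"

lemma maximal_const_ge: "2 ^ CARD('n :: finite) \<le> maximal_const TYPE('n)"
  "(15 * real CARD('n)) ^ CARD('n) * measure lborel (ball (0 :: real ^ 'n) 1) \<le> maximal_const TYPE('n)"
  by (simp_all add: maximal_const_def)

lemma maximal_const_pos: "0 < maximal_const TYPE('n :: finite)"
  by (rule less_le_trans[OF _ maximal_const_ge(1)]) simp

text \<open>Balls of radius at least the diameter of the cube see all its points alike, so only the
  mass near the cube matters, and the weak-type bound applies to that part.\<close>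

lemma maximal_function_superlevel_cube:
  fixes M :: "(real ^ 'n) measure"
  assumes M: "finite_measure M" "sets M = sets borel"
    and P: "P \<in> cubes" and y: "y \<in> P" "maximal_function M y \<le> ennreal m" and "0 < m" "0 < t"
  shows "emeasure lborel {x \<in> P. ennreal (t * m) < maximal_function M x} \<le> ennreal (maximal_const TYPE('n) / t) * emeasure lborel P"
proof (cases "t < 2 ^ CARD('n)")
  case True
  obtain a l where l: "0 < l" and P_eq: "P = cbox a (a + (\<chi> i. l))"
    using P cubeE by blast
  have "emeasure lborel {x \<in> P. ennreal (t * m) < maximal_function M x} \<le> 1 * emeasure lborel P"
    unfolding P_eq by (simp, intro emeasure_mono) auto
  also have "\<dots> \<le> ennreal (maximal_const TYPE('n) / t) * emeasure lborel P"
    using True \<open>0 < t\<close> maximal_const_ge(1)[where 'n = 'n] by (intro mult_right_mono) auto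
  finally show ?thesis .
next
  case False
  obtain a l where l: "0 < l" and P_eq: "P = cbox a (a + (\<chi> i. l))"
    using P cubeE by blast
  interpret finite_measure M by fact
  define N where "N = CARD('n)"
  define V where "V = measure lborel (ball (0 :: real ^ 'n) 1)"
  define R where "R = real N * l"
  have "0 < R" using l by (simp add: R_def N_def)
  \<comment> \<open>Sized to contain every ball of radius less than R that meets the cube: its
    points are within 2R of a point x of the cube, and x is within R of y.\<close>
  define B where "B = ball y (3 * R)"
  define M' where "M' = density M (indicator B)"
  have B: "B \<in> sets M" by (simp add: B_def M)
  have M': "finite_measure M'" "sets M' = sets borel"
    using B M by (auto simp: M'_def finite_measure_restricted)
  have em_M': "emeasure M' S = emeasure M (B \<inter> S)" if "S \<in> sets borel" for S
    unfolding M'_def using B that M by (intro emeasure_restricted) auto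
  let ?S = "{x \<in> P. ennreal (t * m) < maximal_function M x}"
  have "?S \<subseteq> {x. ennreal (t * m) < maximal_function M' x}"
  proof clarify
    fix x assume x: "x \<in> P" "ennreal (t * m) < maximal_function M x"
    then obtain c r where cr: "x \<in> ball c r" "ennreal (t * m) < emeasure M (ball c r) / emeasure lborel (ball c r)"
      by (auto simp: less_maximal_function_iff)
    have "0 < r"
      using cr(1) by (metis ball_eq_empty empty_iff not_less)
    have xy: "dist x y \<le> R"
      unfolding R_def N_def using x(1) y(1) dist_le_in_cube P_eq by blast
    have "r < R"
    proof (rule ccontr)
      \<comment> \<open>The doubled ball contains y, where the maximal function is at most m.
        Doubling costs the factor \<open>2 ^ N\<close>, which t absorbs in this case.\<close>
      assume "\<not> r < R"
      then have "y \<in> ball c (2 * r)"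
        using cr(1) xy dist_triangle[of c y x] by auto
      then have "emeasure M (ball c (2 * r)) \<le> maximal_function M y * emeasure lborel (ball c (2 * r))"
        by (rule emeasure_ball_le_maximal_function)
      also have "\<dots> \<le> ennreal m * emeasure lborel (ball c (2 * r))"
        using y(2) by (rule mult_right_mono) simp
      also have "\<dots> = ennreal (2 ^ N * m) * emeasure lborel (ball c r)"
        using emeasure_ball_scale[of 2 r c c] \<open>0 < r\<close> \<open>0 < m\<close>
        by (simp add: N_def ennreal_mult mult_ac)
      also have "\<dots> \<le> ennreal (t * m) * emeasure lborel (ball c r)"
        using False \<open>0 < m\<close> by (intro mult_right_mono ennreal_leI) (auto simp: N_def)
      also have "\<dots> < emeasure M (ball c r)"
        using cr(2) \<open>0 < r\<close> by (simp add: less_ennreal_divide_ball)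
      also have "\<dots> \<le> emeasure M (ball c (2 * r))"
        using \<open>0 < r\<close> M by (intro emeasure_mono subset_ball) auto
      finally show False by simp
    qed
    have "ball c r \<subseteq> B"
    proof
      fix z assume "z \<in> ball c r"
      then show "z \<in> B"
        unfolding B_def using cr(1) xy \<open>r < R\<close> dist_triangle[of z x c] dist_triangle[of z y x]
        by (simp add: dist_commute)
    qed
    then have "emeasure M' (ball c r) = emeasure M (ball c r)"
      by (simp add: em_M' Int_absorb1)
    then show "ennreal (t * m) < maximal_function M' x"
      using cr less_maximal_function_iff by metis
  qed
  then have "emeasure lborel ?S \<le> emeasure lborel {x. ennreal (t * m) < maximal_function M' x}"
    by (intro emeasure_mono) (auto simp: borel_open open_maximal_function_superlevel)
  then have "ennreal (t * m) * emeasure lborel ?S \<le> ennreal (t * m) * emeasure lborel {x. ennreal (t * m) < maximal_function M' x}"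
    by (intro mult_left_mono) auto
  also have "\<dots> \<le> ennreal (5 ^ N) * emeasure M' UNIV"
    using maximal_function_weak_type[OF M', of "t * m"] \<open>0 < m\<close> \<open>0 < t\<close> by (simp add: N_def)
  also have "emeasure M' UNIV = emeasure M B"
    by (simp add: em_M')
  also have "emeasure M B \<le> ennreal m * emeasure lborel B"
    unfolding B_def
    by (rule order_trans[OF emeasure_ball_le_maximal_function mult_right_mono])
       (use y(2) \<open>0 < R\<close> in auto)
  also have "emeasure lborel B = ennreal ((3 * R) ^ N * V)"
    unfolding B_def using emeasure_ball_scale[of "3 * R" 1 y 0] \<open>0 < R\<close>
    by (simp add: emeasure_lborel_ball_eq N_def V_def ennreal_mult)
  also have "ennreal (5 ^ N) * (ennreal m * ennreal ((3 * R) ^ N * V)) = ennreal (m * ((15 * N) ^ N * V) * l ^ N)"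
  proof -
    have "(15 :: real) ^ N = 5 ^ N * 3 ^ N"
      by (simp flip: power_mult_distrib)
    then have "5 ^ N * (m * ((3 * R) ^ N * V)) = m * ((15 * N) ^ N * V) * l ^ N"
      by (simp add: R_def power_mult_distrib)
    moreover have "0 \<le> (3 * R) ^ N * V"
      using \<open>0 < R\<close> by (simp add: V_def)
    ultimately show ?thesis
      using \<open>0 < m\<close> by (metis ennreal_mult' less_imp_le zero_le_numeral zero_le_power)
  qed
  also have "\<dots> = ennreal m * ennreal ((15 * N) ^ N * V) * ennreal (l ^ N)"
    using \<open>0 < m\<close> l by (simp add: ennreal_mult V_def)
  also have "\<dots> \<le> ennreal m * ennreal (maximal_const TYPE('n)) * ennreal (l ^ N)"
    using maximal_const_ge(2)[where 'n = 'n] by (intro mult_right_mono mult_left_mono ennreal_leI) (auto simp: N_def V_def)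
  also have "ennreal (l ^ N) = emeasure lborel P"
    using measure_lebesgue_cube[of l a] emeasure_lebesgue_cbox_eq[of a "a + (\<chi> i. l)"] l
    by (simp add: P_eq N_def)
  finally have "ennreal (1 / (t * m)) * (ennreal (t * m) * emeasure lborel ?S)
      \<le> ennreal (1 / (t * m)) * (ennreal m * ennreal (maximal_const TYPE('n)) * emeasure lborel P)"
    by (intro mult_left_mono) (simp_all add: mult_left_mono)
  moreover have "ennreal (1 / (t * m)) * ennreal (t * m) = 1"
    using \<open>0 < m\<close> \<open>0 < t\<close> by (subst ennreal_mult'[symmetric]) auto
  moreover have "ennreal (1 / (t * m)) * (ennreal m * ennreal (maximal_const TYPE('n))) = ennreal (maximal_const TYPE('n) / t)"
    using \<open>0 < m\<close> \<open>0 < t\<close> maximal_const_pos[where 'n = 'n] by (simp flip: ennreal_mult')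
  ultimately show ?thesis
    by (simp add: mult.assoc[symmetric])
qed

section \<open>Finiteness and logarithm of the maximal function\<close>

lemma AE_maximal_function_finite:
  fixes M :: "'a :: euclidean_space measure"
  assumes M: "finite_measure M" "sets M = sets borel"
  shows "AE x in lborel. maximal_function M x < \<infinity>"
proof -
  interpret finite_measure M by fact
  define A where "A = {x. maximal_function M x = \<infinity>}"
  define K where "K = 5 ^ DIM('a) * measure M UNIV"
  have A: "A \<in> sets lborel"
    unfolding A_def by measurable
  have le: "emeasure lborel A \<le> ennreal (K / real (Suc k))" for k
  proof -
    have "ennreal (real (Suc k)) * emeasure lborel A \<le> ennreal (real (Suc k)) * emeasure lborel {x. ennreal (real (Suc k)) < maximal_function M x}"
      by (intro mult_left_mono emeasure_mono) (auto simp: A_def borel_open open_maximal_function_superlevel simp del: of_nat_Suc)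
    also have "\<dots> \<le> ennreal (5 ^ DIM('a)) * emeasure M UNIV"
      by (rule maximal_function_weak_type[OF M]) simp
    also have "\<dots> = ennreal K"
      by (simp add: K_def emeasure_eq_measure ennreal_mult'[symmetric])
    finally have "ennreal (1 / real (Suc k)) * (ennreal (real (Suc k)) * emeasure lborel A) \<le> ennreal (1 / real (Suc k)) * ennreal K"
      by (intro mult_left_mono) auto
    then show ?thesis
      by (simp add: mult.assoc[symmetric] ennreal_mult''[symmetric] ennreal_mult'[symmetric] del: of_nat_Suc)
  qed
  have "(\<lambda>k. K / real (Suc k)) \<longlonglongrightarrow> 0"
    using LIMSEQ_Suc[OF lim_const_over_n[of K]] by simp
  then have "(\<lambda>k. ennreal (K / real (Suc k))) \<longlonglongrightarrow> ennreal 0"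
    by (rule tendsto_ennrealI)
  then have "emeasure lborel A \<le> ennreal 0"
    using le by (intro LIMSEQ_le_const) auto
  then have "A \<in> null_sets lborel"
    using A by auto
  then have "AE x in lborel. x \<notin> A"
    by (rule AE_not_in)
  then show ?thesis
    by eventually_elim (simp add: A_def top.not_eq_extremum)
qed

text \<open>\<open>enn2real\<close> sends \<infinity> to 0, so the value is 0 where the maximal
  function is infinite, a null set for a finite Borel measure. With base 2, unit steps of the
  logarithm are the levels \<open>2 ^ k\<close> of a geometric decay.\<close>

definition log_maximal :: "'a :: euclidean_space measure \<Rightarrow> 'a \<Rightarrow> real" where
  "log_maximal M x = log 2 (max 1 (enn2real (maximal_function M x)))"

lemma borel_measurable_log_maximal [measurable]: "log_maximal M \<in> borel_measurable borel"
  unfolding log_maximal_def[abs_def] by measurable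

lemma log_maximal_nonneg: "0 \<le> log_maximal M x"
  by (simp add: log_maximal_def)

lemma less_log_maximal_iff:
  assumes "0 \<le> c"
  shows "c < log_maximal M x \<longleftrightarrow> 2 powr c < enn2real (maximal_function M x)"
proof -
  have "1 \<le> 2 powr c" using assms by (simp add: ge_one_powr_ge_zero)
  then show ?thesis
    unfolding log_maximal_def by (subst less_log_iff) auto
qed

lemma ennreal_less_if_less_enn2real:
  assumes "0 \<le> c" "c < enn2real y"
  shows "ennreal c < y"
  using assms by (cases y) (auto simp: ennreal_less_iff)

lemma superlevel_log_maximal_subset:
  assumes "0 \<le> c"
  shows "{x \<in> A. c < log_maximal M x} \<subseteq> {x \<in> A. ennreal (2 powr c) < maximal_function M x}"
  using assms by (auto simp: less_log_maximal_iff ennreal_less_if_less_enn2real)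

text \<open>Take for c the logarithm of the infimum over P, cut off at 1. Almost everywhere on P the
  function is at least c, and it exceeds c by more than k only where the maximal function exceeds
  \<open>2 ^ k * m0\<close>, a set whose share of P decays like 2^(-k) by
  \<open>maximal_function_superlevel_cube\<close>.\<close>

lemma log_maximal_mean_oscillation:
  fixes M :: "(real ^ 'n) measure"
  assumes M: "finite_measure M" "sets M = sets borel" and P: "P \<in> cubes"
  obtains c where "(\<integral>\<^sup>+x. ennreal \<bar>log_maximal M x - c\<bar> * indicator P x \<partial>lborel)
    \<le> ennreal (4 * maximal_const TYPE('n)) * emeasure lborel P"
proof -
  have P_borel [measurable]: "P \<in> sets borel"
    using P by (auto elim: cubeE)
  have P_pos: "emeasure lborel P \<noteq> 0"
    using measure_cube_pos[OF P] emeasure_cube[OF P] P_borel by auto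
  define i0 where "i0 = (INF y\<in>P. maximal_function M y)"
  have "i0 < \<infinity>"
  proof (rule ccontr)
    assume "\<not> i0 < \<infinity>"
    then have "maximal_function M y = \<infinity>" if "y \<in> P" for y
      using that INF_lower[of y P "maximal_function M"] by (auto simp: i0_def top.not_eq_extremum[symmetric] top_unique)
    then have "AE x in lborel. x \<notin> P"
      using AE_maximal_function_finite[OF M] by (auto elim!: eventually_mono)
    then have "P \<in> null_sets lborel"
      using AE_iff_null_sets[of P lborel] P_borel by auto
    then show False using P_pos by auto
  qed
  define m0 where "m0 = max 1 (enn2real i0)"
  have m0: "1 \<le> m0" "i0 < ennreal (2 * m0)"
  proof -
    show "1 \<le> m0" by (simp add: m0_def)
    have "i0 = ennreal (enn2real i0)"
      using \<open>i0 < \<infinity>\<close> by simp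
    also have "\<dots> < ennreal (2 * m0)"
      by (intro ennreal_lessI) (auto simp: m0_def)
    finally show "i0 < ennreal (2 * m0)" .
  qed
  \<comment> \<open>The infimum need not be attained; the factor 2 leaves room for a point y, even
    if the infimum is 0. It is paid back below by \<open>t = 2 ^ k / 2\<close>.\<close>
  obtain y where y: "y \<in> P" "maximal_function M y \<le> ennreal (2 * m0)"
    using m0(2) unfolding i0_def INF_less_iff by (auto intro: less_imp_le)
  define c where "c = log 2 m0"
  have "0 \<le> c" using m0(1) by (simp add: c_def)
  have ge: "c \<le> log_maximal M x" if "x \<in> P" "maximal_function M x < \<infinity>" for x
  proof -
    have "i0 \<le> maximal_function M x"
      unfolding i0_def using that(1) by (rule INF_lower)
    then have "enn2real i0 \<le> enn2real (maximal_function M x)"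
      using that(2) by (intro enn2real_mono) auto
    then show ?thesis
      using m0(1) unfolding c_def log_maximal_def m0_def by (intro log_mono) auto
  qed
  have "(\<integral>\<^sup>+x. ennreal \<bar>log_maximal M x - c\<bar> * indicator P x \<partial>lborel)
      \<le> (\<integral>\<^sup>+x. ennreal (log_maximal M x - c) * indicator P x \<partial>lborel)"
    using AE_maximal_function_finite[OF M]
    by (intro nn_integral_mono_AE, eventually_elim) (use ge in \<open>auto simp: indicator_def\<close>)
  also have "\<dots> \<le> ennreal (1 / (1 - 1 / 2)) * (ennreal (2 * maximal_const TYPE('n)) * emeasure lborel P)"
  proof (rule nn_integral_le_of_superlevel_decay)
    fix k
    have "{x \<in> P. real k < log_maximal M x - c} = {x \<in> P. real k + c < log_maximal M x}"
      by auto
    also have "\<dots> \<subseteq> {x \<in> P. ennreal (2 powr (real k + c)) < maximal_function M x}"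
      using \<open>0 \<le> c\<close> by (intro superlevel_log_maximal_subset) simp
    also have "2 powr (real k + c) = 2 ^ k / 2 * (2 * m0)"
      using m0(1) by (simp add: powr_add powr_realpow c_def)
    finally have "emeasure lborel {x \<in> P. real k < log_maximal M x - c}
        \<le> emeasure lborel {x \<in> P. ennreal (2 ^ k / 2 * (2 * m0)) < maximal_function M x}"
      by (intro emeasure_mono) auto
    also have "\<dots> \<le> ennreal (maximal_const TYPE('n) / (2 ^ k / 2)) * emeasure lborel P"
      using m0(1) by (intro maximal_function_superlevel_cube[OF M P y]) auto
    also have "maximal_const TYPE('n) / (2 ^ k / 2) = (1 / 2) ^ k * (2 * maximal_const TYPE('n))"
      by (simp add: field_simps)
    finally show "emeasure lborel {x \<in> P. real k < log_maximal M x - c}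
        \<le> ennreal ((1 / 2) ^ k) * (ennreal (2 * maximal_const TYPE('n)) * emeasure lborel P)"
      by (simp add: ennreal_mult' mult.assoc)
  qed auto
  also have "\<dots> = ennreal (4 * maximal_const TYPE('n)) * emeasure lborel P"
    by (subst mult.assoc[symmetric], subst ennreal_mult'[symmetric]) auto
  finally show ?thesis by (rule that)
qed

text \<open>The weak-type inequality at the levels \<open>2 ^ k\<close> gives a bound by the total
  mass, whatever the size of Q. For mass comparable to |Q| this bounds the average over Q.\<close>

lemma log_maximal_integral_le:
  fixes M :: "'a :: euclidean_space measure"
  assumes M: "finite_measure M" "sets M = sets borel" and Q: "Q \<in> sets borel"
  shows "(\<integral>\<^sup>+x. ennreal (log_maximal M x) * indicator Q x \<partial>lborel) \<le> ennreal (2 * 5 ^ DIM('a)) * emeasure M UNIV"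
proof -
  have "(\<integral>\<^sup>+x. ennreal (log_maximal M x) * indicator Q x \<partial>lborel)
      \<le> ennreal (1 / (1 - 1 / 2)) * (ennreal (5 ^ DIM('a)) * emeasure M UNIV)"
  proof (rule nn_integral_le_of_superlevel_decay)
    fix k
    have "ennreal (2 ^ k) * emeasure lborel {x \<in> Q. real k < log_maximal M x}
        \<le> ennreal (2 ^ k) * emeasure lborel {x. ennreal (2 ^ k) < maximal_function M x}"
      using superlevel_log_maximal_subset[of "real k" Q M]
      by (intro mult_left_mono emeasure_mono) (auto simp: powr_realpow)
    also have "\<dots> \<le> ennreal (5 ^ DIM('a)) * emeasure M UNIV"
      by (intro maximal_function_weak_type M) simp
    finally have "ennreal ((1 / 2) ^ k) * (ennreal (2 ^ k) * emeasure lborel {x \<in> Q. real k < log_maximal M x})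
        \<le> ennreal ((1 / 2) ^ k) * (ennreal (5 ^ DIM('a)) * emeasure M UNIV)"
      by (intro mult_left_mono) auto
    moreover have "ennreal ((1 / 2) ^ k) * ennreal (2 ^ k) = 1"
      by (subst ennreal_mult'[symmetric]) (auto simp: power_mult_distrib[symmetric])
    ultimately show "emeasure lborel {x \<in> Q. real k < log_maximal M x}
        \<le> ennreal ((1 / 2) ^ k) * (ennreal (5 ^ DIM('a)) * emeasure M UNIV)"
      by (simp add: mult.assoc[symmetric])
  qed (use Q in auto)
  also have "\<dots> = ennreal (2 * 5 ^ DIM('a)) * emeasure M UNIV"
    by (subst mult.assoc[symmetric], subst ennreal_mult'[symmetric]) auto
  finally show ?thesis .
qed

section \<open>Mean oscillation bounds and the BMO majorant of a chain\<close>

lemma integrable_on_cube_if_mean_oscillation: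
  fixes h :: "real ^ 'n \<Rightarrow> real"
  assumes h: "h \<in> borel_measurable lebesgue" and P: "P \<in> cubes"
    and osc: "(\<integral>\<^sup>+x. ennreal \<bar>h x - c\<bar> * indicator P x \<partial>lebesgue) \<le> ennreal K * emeasure lebesgue P"
  shows "integrable (lebesgue_on P) h"
proof -
  have "integrable (lebesgue_on P) (\<lambda>x. h x - c)"
  proof (rule integrableI_bounded)
    show "(\<lambda>x. h x - c) \<in> borel_measurable (lebesgue_on P)"
      using h by (intro measurable_restrict_space1) auto
    have "(\<integral>\<^sup>+x. ennreal (norm (h x - c)) \<partial>lebesgue_on P) \<le> ennreal K * emeasure lebesgue P"
      using osc sets_cube[OF P] by (subst nn_integral_restrict_space) auto
    also have "\<dots> < \<infinity>"
      by (simp add: emeasure_cube[OF P] ennreal_mult_less_top del: emeasure_completion)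
    finally show "(\<integral>\<^sup>+x. ennreal (norm (h x - c)) \<partial>lebesgue_on P) < \<infinity>" .
  qed
  then have "integrable (lebesgue_on P) (\<lambda>x. (h x - c) + c)"
    using integrable_const_cube[OF P] by (rule Bochner_Integration.integrable_add)
  then show ?thesis by simp
qed

text \<open>The average over P is within K of the constant c, whence the factor 2. Local
  integrability follows by enclosing a compact set in a cube.\<close>

lemma BMO_if_mean_oscillation:
  fixes h :: "real ^ 'n \<Rightarrow> real"
  assumes h: "h \<in> borel_measurable lebesgue" and "0 \<le> K"
    and osc: "\<And>P. P \<in> cubes \<Longrightarrow>
      \<exists>c. (\<integral>\<^sup>+x. ennreal \<bar>h x - c\<bar> * indicator P x \<partial>lebesgue) \<le> ennreal K * emeasure lebesgue P"
  shows "h \<in> BMO" "bmo_norm h \<le> ennreal (2 * K)"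
proof -
  have int: "integrable (lebesgue_on P) h" if "P \<in> cubes" for P
    using integrable_on_cube_if_mean_oscillation[OF h that] osc[OF that] by blast
  show norm: "bmo_norm h \<le> ennreal (2 * K)"
    unfolding bmo_norm_def
  proof (intro SUP_least ennreal_leI)
    fix P :: "(real ^ 'n) set" assume P: "P \<in> cubes"
    obtain c where c: "(\<integral>\<^sup>+x. ennreal \<bar>h x - c\<bar> * indicator P x \<partial>lebesgue) \<le> ennreal K * emeasure lebesgue P"
      using osc[OF P] by blast
    have int_c: "integrable (lebesgue_on P) (\<lambda>x. h x - d)" for d
      using int[OF P] integrable_const_cube[OF P] by auto
    have "ennreal (average P (\<lambda>x. \<bar>h x - c\<bar>)) * emeasure lebesgue P \<le> ennreal K * emeasure lebesgue P"
      using c nn_integral_cube_eq_average[OF P int_c[of c]] by simp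
    then have avg: "average P (\<lambda>x. \<bar>h x - c\<bar>) \<le> K"
      using measure_cube_pos[OF P] \<open>0 \<le> K\<close>
      by (simp add: emeasure_cube[OF P] ennreal_mult''[symmetric] ennreal_le_iff del: emeasure_completion measure_completion)
    \<comment> \<open>The constant is added by subtracting its negative, the form to which
      \<open>average_diff_const\<close> applies.\<close>
    have "average P (\<lambda>x. \<bar>h x - average P h\<bar>) \<le> average P (\<lambda>x. \<bar>h x - c\<bar> - (- \<bar>average P h - c\<bar>))"
      unfolding average_def[of P "\<lambda>x. \<bar>h x - average P h\<bar>"] average_def[of P "\<lambda>x. \<bar>h x - c\<bar> - (- \<bar>average P h - c\<bar>)"]
      using measure_cube_pos[OF P] int[OF P] integrable_const_cube[OF P]
      by (intro divide_right_mono integral_mono integrable_abs Bochner_Integration.integrable_diff) auto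
    also have "\<dots> = average P (\<lambda>x. \<bar>h x - c\<bar>) + \<bar>average P h - c\<bar>"
      using average_diff_const[OF P integrable_abs[OF int_c], of c "- \<bar>average P h - c\<bar>"] by simp
    also have "\<dots> \<le> 2 * K"
      using avg abs_average_diff_le[OF P int[OF P], of c] by simp
    finally show "average P (\<lambda>x. \<bar>h x - average P h\<bar>) \<le> 2 * K" .
  qed
  have "locally_integrable h"
    unfolding locally_integrable_def
  proof (intro allI impI)
    fix L :: "(real ^ 'n) set" assume L: "compact L"
    obtain B where B: "0 < B" "\<And>x. x \<in> L \<Longrightarrow> norm x \<le> B"
      using compact_imp_bounded[OF L] bounded_pos by blast
    define P where "P = cbox (\<chi> i. - B) ((\<chi> i. - B) + (\<chi> i. 2 * B) :: real ^ 'n)"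
    have P: "P \<in> cubes"
      unfolding P_def using B(1) by (intro cbox_in_cubes) simp
    have "L \<subseteq> P"
    proof
      fix x assume "x \<in> L"
      then have "\<bar>x $ i\<bar> \<le> B" for i
        using B(2) component_le_norm_cart order_trans by blast
      then show "x \<in> P"
        by (auto simp: P_def mem_box_cart abs_le_iff minus_le_iff)
    qed
    moreover have "L \<in> sets lebesgue"
      using L by (simp add: compact_imp_closed)
    ultimately show "integrable (lebesgue_on L) h"
      using int[OF P] sets_cube[OF P] set_integrable_subset[of lebesgue P h L]
      by (simp add: integrable_restrict_space set_integrable_def)
  qed
  moreover have "bmo_norm h < \<infinity>"
    using norm by (rule le_less_trans) simp
  ultimately show "h \<in> BMO"
    by (simp add: BMO_def)
qed

text \<open>The oscillation bound on every cube P will give membership in BMO; the integral bound on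
  Q alone controls the average that \<open>bmo_norm_on\<close> subtracts there.\<close>

lemma thin_chain_majorant:
  fixes Q :: "(real ^ 'n) set"
  assumes Q: "Q \<in> cubes" and \<Omega>: "thin_chain Q \<Omega>"
  defines "L \<equiv> log 2 (3 / 2)"
  obtains f where "f \<in> borel_measurable borel" "\<And>x. 0 \<le> f x"
    "AE x in lebesgue. \<bar>sum_indicators \<Omega> x\<bar> \<le> f x"
    "\<And>P. P \<in> cubes \<Longrightarrow> \<exists>c. (\<integral>\<^sup>+x. ennreal \<bar>f x - c\<bar> * indicator P x \<partial>lebesgue)
      \<le> ennreal (4 * maximal_const TYPE('n) / L) * emeasure lebesgue P"
    "(\<integral>\<^sup>+x. ennreal (f x) * indicator Q x \<partial>lebesgue) \<le> ennreal (1 + 16 * 5 ^ CARD('n) / L) * emeasure lebesgue Q"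
proof -
  have "0 < L" by (simp add: L_def)
  have "\<exists>U. open U \<and> \<Omega> k \<subseteq> U \<and> emeasure lborel U \<le> ennreal (2 * (1 / 2) ^ k * measure lebesgue Q)" for k
  proof -
    have e: "0 < (1 / 2) ^ k * measure lebesgue Q"
      using measure_cube_pos[OF Q] by simp
    have \<Omega>_k: "\<Omega> k \<in> sets lebesgue"
      using \<Omega> by (simp add: thin_chain_def)
    obtain U where U: "open U" "\<Omega> k \<subseteq> U" "(U - \<Omega> k) \<in> lmeasurable"
      "emeasure lebesgue (U - \<Omega> k) < ennreal ((1 / 2) ^ k * measure lebesgue Q)"
      using sets_lebesgue_outer_open[OF \<Omega>_k e] by blast
    have "emeasure lborel U = emeasure lebesgue (\<Omega> k \<union> (U - \<Omega> k))"
      using U(1,2) by (simp add: Un_absorb1)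
    also have "\<dots> \<le> emeasure lebesgue (\<Omega> k) + emeasure lebesgue (U - \<Omega> k)"
      using U(3) \<Omega>_k by (intro emeasure_subadditive) auto
    also have "\<dots> \<le> ennreal ((1 / 2) ^ k * measure lebesgue Q) + ennreal ((1 / 2) ^ k * measure lebesgue Q)"
      using U(4) thin_chain_emeasure_le[OF \<Omega> Q, of k] by (intro add_mono) (auto simp: less_imp_le)
    also have "\<dots> = ennreal (2 * (1 / 2) ^ k * measure lebesgue Q)"
      using e by (subst ennreal_plus[symmetric]) (auto simp del: measure_completion)
    finally show ?thesis using U by blast
  qed
  then obtain U where U: "\<And>k. open (U k)" "\<And>k. \<Omega> k \<subseteq> U k"
    "\<And>k. emeasure lborel (U k) \<le> ennreal (2 * (1 / 2) ^ k * measure lebesgue Q)"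
    by metis
  have U_borel [measurable]: "U k \<in> sets borel" for k
    using U(1) by simp
  \<comment> \<open>The base 3/2 lies between 1 and 2: above 1, the logarithm sees its powers; below
    2, the masses \<open>(3 / 2) ^ k * (2 * (1 / 2) ^ k)\<close> have a finite sum, namely
    8.\<close>
  define w :: "real ^ 'n \<Rightarrow> ennreal" where "w x = (\<Sum>k. ennreal ((3 / 2) ^ k) * indicator (U k) x)" for x
  have w [measurable]: "w \<in> borel_measurable lborel"
    unfolding w_def[abs_def] by measurable
  define M where "M = density lborel w"
  have M_sets: "sets M = sets borel"
    by (simp add: M_def)
  have M_UNIV: "emeasure M UNIV \<le> ennreal (8 * measure lebesgue Q)"
  proof -
    have "emeasure M UNIV = (\<integral>\<^sup>+x. w x \<partial>lborel)"
      unfolding M_def by (subst emeasure_density) auto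
    also have "\<dots> = (\<Sum>k. ennreal ((3 / 2) ^ k) * emeasure lborel (U k))"
      unfolding w_def by (subst nn_integral_suminf) (auto simp: nn_integral_cmult_indicator)
    also have "\<dots> \<le> (\<Sum>k. ennreal ((3 / 2) ^ k) * ennreal (2 * (1 / 2) ^ k * measure lebesgue Q))"
      by (intro suminf_le mult_left_mono U(3)) auto
    also have "\<dots> = (\<Sum>k. ennreal ((3 / 4) ^ k * (2 * measure lebesgue Q)))"
    proof (rule suminf_cong)
      fix k
      have "(3 / 2) ^ k * (2 * (1 / 2) ^ k * measure lebesgue Q) = (3 / 2 * (1 / 2)) ^ k * (2 * measure lebesgue Q)"
        unfolding power_mult_distrib by simp
      then show "ennreal ((3 / 2) ^ k) * ennreal (2 * (1 / 2) ^ k * measure lebesgue Q) = ennreal ((3 / 4) ^ k * (2 * measure lebesgue Q))"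
        by (subst ennreal_mult'[symmetric]) (auto simp del: measure_completion)
    qed
    also have "\<dots> = ennreal (1 / (1 - 3 / 4) * (2 * measure lebesgue Q))"
      by (intro suminf_ennreal_eq sums_mult2 geometric_sums) auto
    finally show ?thesis by (simp del: measure_completion)
  qed
  have M_fin: "finite_measure M"
  proof (rule finite_measureI)
    have "space M = UNIV" by (simp add: M_def)
    moreover have "emeasure M UNIV < \<infinity>"
      using M_UNIV by (rule le_less_trans) simp
    ultimately show "emeasure M (space M) \<noteq> \<infinity>" by simp
  qed
  have max_ge: "ennreal ((3 / 2) ^ k) \<le> maximal_function M x" if x_U: "x \<in> U k" for x k
  proof -
    obtain r where r: "0 < r" "ball x r \<subseteq> U k"
      using U(1) x_U openE by blast
    have "ennreal ((3 / 2) ^ k) * emeasure lborel (ball x r) = (\<integral>\<^sup>+y. ennreal ((3 / 2) ^ k) * indicator (ball x r) y \<partial>lborel)"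
      by (subst nn_integral_cmult_indicator) auto
    also have "\<dots> \<le> (\<integral>\<^sup>+y. w y * indicator (ball x r) y \<partial>lborel)"
    proof (rule nn_integral_mono)
      fix y
      show "ennreal ((3 / 2) ^ k) * indicator (ball x r) y \<le> w y * indicator (ball x r) y"
      proof (cases "y \<in> ball x r")
        case True
        then have "ennreal ((3 / 2) ^ k) = (\<Sum>j\<in>{k}. ennreal ((3 / 2) ^ j) * indicator (U j) y)"
          using r(2) by (auto simp: indicator_def)
        also have "\<dots> \<le> w y"
          unfolding w_def by (rule sum_le_suminf) auto
        finally show ?thesis using True by simp
      qed simp
    qed
    also have "\<dots> = emeasure M (ball x r)"
      unfolding M_def by (subst emeasure_density) auto
    finally have "ennreal ((3 / 2) ^ k) * emeasure lborel (ball x r) / emeasure lborel (ball x r)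
        \<le> emeasure M (ball x r) / emeasure lborel (ball x r)"
      by (rule divide_right_mono_ennreal)
    moreover have "ennreal ((3 / 2) ^ k) * emeasure lborel (ball x r) / emeasure lborel (ball x r) = ennreal ((3 / 2) ^ k)"
      using r(1) by (intro mult_divide_eq_ennreal) (auto simp: emeasure_lborel_ball_eq)
    moreover have "emeasure M (ball x r) / emeasure lborel (ball x r) \<le> maximal_function M x"
      unfolding maximal_function_def using r(1) by (intro SUP_upper2[of "(x, r)"]) auto
    ultimately show ?thesis by (metis order_trans)
  qed
  \<comment> \<open>Division by L changes the base from 2 to 3/2. The summand 1 pays for an index
    shift: a point in exactly N > 0 of the sets has N - 1 as its largest index.\<close>
  define f where "f x = 1 + log_maximal M x / L" for x
  show ?thesis
  proof
    show f_borel: "f \<in> borel_measurable borel"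
      unfolding f_def[abs_def] by measurable
    show "0 \<le> f x" for x
      using log_maximal_nonneg[of M x] \<open>0 < L\<close> by (simp add: f_def)
    have "AE x in lebesgue. maximal_function M x < \<infinity>"
      using AE_maximal_function_finite[OF M_fin M_sets] by (rule AE_completion)
    then show "AE x in lebesgue. \<bar>sum_indicators \<Omega> x\<bar> \<le> f x"
      using thin_chain_Inter_null[OF \<Omega> Q]
    proof eventually_elim
      fix x assume fin: "maximal_function M x < \<infinity>" and x: "x \<notin> (\<Inter>k. \<Omega> k)"
      have "\<Omega> (Suc k) \<subseteq> \<Omega> k" for k
        using \<Omega> by (simp add: thin_chain_def)
      then obtain N where N: "\<And>k. x \<in> \<Omega> k \<longleftrightarrow> k < N"
        using nested_countingE[of \<Omega> x] x by blast
      have "real N \<le> f x"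
      proof (cases N)
        case 0
        then show ?thesis
          using log_maximal_nonneg[of M x] \<open>0 < L\<close> by (simp add: f_def)
      next
        case (Suc j)
        then have "x \<in> U j"
          using N U(2) by blast
        then have "enn2real (ennreal ((3 / 2) ^ j)) \<le> enn2real (maximal_function M x)"
          using fin by (intro enn2real_mono max_ge) auto
        then have "log 2 ((3 / 2) ^ j) \<le> log_maximal M x"
          unfolding log_maximal_def by (intro log_mono) auto
        then have "real j * L \<le> log_maximal M x"
          by (simp add: L_def log_nat_power)
        then show ?thesis
          using \<open>0 < L\<close> by (simp add: f_def Suc field_simps)
      qed
      then show "\<bar>sum_indicators \<Omega> x\<bar> \<le> f x"
        using sum_indicators_eq[OF N] by simp
    qed
    show "\<exists>c. (\<integral>\<^sup>+x. ennreal \<bar>f x - c\<bar> * indicator P x \<partial>lebesgue)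
      \<le> ennreal (4 * maximal_const TYPE('n) / L) * emeasure lebesgue P" if P: "P \<in> cubes" for P
    proof -
      obtain c where c: "(\<integral>\<^sup>+x. ennreal \<bar>log_maximal M x - c\<bar> * indicator P x \<partial>lborel)
          \<le> ennreal (4 * maximal_const TYPE('n)) * emeasure lborel P"
        using log_maximal_mean_oscillation[OF M_fin M_sets P] .
      have P_borel [measurable]: "P \<in> sets borel"
        using P by (auto elim: cubeE)
      have "(\<integral>\<^sup>+x. ennreal \<bar>f x - (1 + c / L)\<bar> * indicator P x \<partial>lebesgue)
          = (\<integral>\<^sup>+x. ennreal (1 / L) * (ennreal \<bar>log_maximal M x - c\<bar> * indicator P x) \<partial>lborel)"
        unfolding nn_integral_completion
      proof (rule nn_integral_cong)
        fix x
        have "\<bar>f x - (1 + c / L)\<bar> = 1 / L * \<bar>log_maximal M x - c\<bar>"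
          using \<open>0 < L\<close> by (simp add: f_def abs_div diff_divide_distrib[symmetric])
        then show "ennreal \<bar>f x - (1 + c / L)\<bar> * indicator P x = ennreal (1 / L) * (ennreal \<bar>log_maximal M x - c\<bar> * indicator P x)"
          using \<open>0 < L\<close> by (cases "x \<in> P") (simp_all add: ennreal_mult'[symmetric])
      qed
      also have "\<dots> \<le> ennreal (1 / L) * (ennreal (4 * maximal_const TYPE('n)) * emeasure lborel P)"
        using c by (subst nn_integral_cmult) (auto intro: mult_left_mono)
      also have "\<dots> = ennreal (4 * maximal_const TYPE('n) / L) * emeasure lebesgue P"
        using \<open>0 < L\<close> by (subst mult.assoc[symmetric], subst ennreal_mult'[symmetric]) auto
      finally show ?thesis by blast
    qed
    have Q_borel [measurable]: "Q \<in> sets borel"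
      using Q by (auto elim: cubeE)
    have "(\<integral>\<^sup>+x. ennreal (f x) * indicator Q x \<partial>lebesgue)
        = (\<integral>\<^sup>+x. indicator Q x + ennreal (1 / L) * (ennreal (log_maximal M x) * indicator Q x) \<partial>lborel)"
      unfolding nn_integral_completion
      using \<open>0 < L\<close> log_maximal_nonneg[of M]
      by (intro nn_integral_cong) (auto simp: f_def indicator_def ennreal_mult'[symmetric] simp flip: ennreal_1 ennreal_plus)
    also have "\<dots> = emeasure lborel Q + ennreal (1 / L) * (\<integral>\<^sup>+x. ennreal (log_maximal M x) * indicator Q x \<partial>lborel)"
      by (subst nn_integral_add) (auto simp: nn_integral_cmult)
    also have "\<dots> \<le> emeasure lborel Q + ennreal (1 / L) * (ennreal (2 * 5 ^ CARD('n)) * ennreal (8 * measure lebesgue Q))"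
    proof (intro add_left_mono mult_left_mono)
      have "(\<integral>\<^sup>+x. ennreal (log_maximal M x) * indicator Q x \<partial>lborel) \<le> ennreal (2 * 5 ^ CARD('n)) * emeasure M UNIV"
        using log_maximal_integral_le[OF M_fin M_sets Q_borel] by simp
      also have "\<dots> \<le> ennreal (2 * 5 ^ CARD('n)) * ennreal (8 * measure lebesgue Q)"
        using M_UNIV by (rule mult_left_mono) simp
      finally show "(\<integral>\<^sup>+x. ennreal (log_maximal M x) * indicator Q x \<partial>lborel) \<le> ennreal (2 * 5 ^ CARD('n)) * ennreal (8 * measure lebesgue Q)" .
    qed simp
    also have "\<dots> = ennreal (measure lebesgue Q + 1 / L * (2 * 5 ^ CARD('n) * (8 * measure lebesgue Q)))"
      using \<open>0 < L\<close> emeasure_cube[OF Q] Q_borel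
      by (simp add: ennreal_mult'[symmetric] ennreal_plus[symmetric] del: ennreal_plus)
    also have "\<dots> = ennreal (1 + 16 * 5 ^ CARD('n) / L) * emeasure lebesgue Q"
      using \<open>0 < L\<close>
      by (simp add: emeasure_cube[OF Q] ennreal_mult'[symmetric] algebra_simps del: emeasure_completion measure_completion)
    finally show "(\<integral>\<^sup>+x. ennreal (f x) * indicator Q x \<partial>lebesgue) \<le> ennreal (1 + 16 * 5 ^ CARD('n) / L) * emeasure lebesgue Q" .
  qed
qed

text \<open>One side is halved, in an arbitrary direction j. The set on which the majorant is
  lowered will be cut out of H, so its complement keeps at least half of Q.\<close>

lemma half_cube:
  fixes Q :: "(real ^ 'n) set"
  assumes "Q \<in> cubes"
  obtains H where "H \<in> sets lebesgue" "H \<subseteq> Q" "measure lebesgue H = measure lebesgue Q / 2"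
proof -
  obtain a l where l: "0 < l" and Q: "Q = cbox a (a + (\<chi> i. l))"
    using assms cubeE by blast
  obtain j :: 'n where True by simp
  define b where "b = a + (\<chi> i. l * (if i = j then 1 / 2 else 1))"
  show ?thesis
  proof
    show "cbox a b \<in> sets lebesgue" by simp
    show "cbox a b \<subseteq> Q"
    proof
      fix x assume x: "x \<in> cbox a b"
      have "a $ i \<le> x $ i \<and> x $ i \<le> a $ i + l" for i
      proof -
        have "a $ i \<le> x $ i" "x $ i \<le> a $ i + l * (if i = j then 1 / 2 else 1)"
          using x by (simp_all add: mem_box_cart b_def del: mult_cancel_left1)
        moreover have "l * (if i = j then 1 / 2 else 1) \<le> l"
          using l by simp
        ultimately show ?thesis by linarith
      qed
      then show "x \<in> Q"
        by (simp add: Q mem_box_cart)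
    qed
    have "measure lebesgue (cbox a b) = (\<Prod>i\<in>UNIV. l * (if i = j then 1 / 2 else 1))"
      using l by (subst measure_completion, simp, subst content_cbox_cart) (auto simp: interval_ne_empty_cart b_def)
    also have "\<dots> = l ^ CARD('n) / 2"
      by (simp add: prod.distrib prod.delta)
    finally show "measure lebesgue (cbox a b) = measure lebesgue Q / 2"
      using measure_lebesgue_cube[of l a] l by (simp add: Q del: measure_completion)
  qed
qed

section \<open>Equivalence of the embeddings\<close>

text \<open>Since the constants in the quasi-triangle inequalities of the spaces are not uniformly bounded,
  the average of the majorant \<open>f\<close> cannot be split off. Instead \<open>f\<close> is lowered by a constant on a set
  \<open>F\<close> on which it is bounded and which, like its complement, has measure comparable to that of \<open>Q\<close>:
  this moves the average into the gap between the values on \<open>F\<close> and those on \<open>Q - F\<close>.\<close>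

proposition BMO_embedding_imp_chain_bound:
  fixes X :: "(real ^ 'n) set \<Rightarrow> (real ^ 'n) fspace"
  assumes X: "\<And>Q. Q \<in> cubes \<Longrightarrow> quasi_banach_function_space Q (X Q)"
    and C: "0 < C" "\<And>f. f \<in> BMO \<Longrightarrow> bmo_norm_on X f \<le> ennreal C * bmo_norm f"
  shows "\<exists>D>0. chain_bound X D"
proof -
  define L :: real where "L = log 2 (3 / 2)"
  define K1 where "K1 = 4 * maximal_const TYPE('n) / L"
  define K2 where "K2 = 1 + 16 * 5 ^ CARD('n) / L"
  \<comment> \<open>The average falls by \<open>A * \<theta>\<close> with \<theta> between 1/4 and
    1/2. Off F this gains at least \<open>4 * K2\<close>, more than the average
    \<open>m \<le> K2\<close> that is subtracted. On F, \<open>h - average Q h\<close> is at most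
    \<open>f - 8 * K2\<close>, and as \<open>f \<le> 4 * K2\<close> there, its modulus is at least
    f.\<close>
  define A where "A = 16 * K2"
  have "0 < L" by (simp add: L_def)
  then have pos: "0 < K1" "0 < K2" "0 < A"
    using maximal_const_pos[where 'n = 'n] by (auto simp: K1_def K2_def A_def intro!: add_pos_pos divide_pos_pos)
  have "chain_bound X (C * (2 * (K1 + A)))"
    unfolding chain_bound_def
  proof (intro ballI allI impI)
    fix Q :: "(real ^ 'n) set" and \<Omega> assume Q: "Q \<in> cubes" and \<Omega>: "thin_chain Q \<Omega>"
    interpret quasi_banach_function_space Q "X Q" by (rule X[OF Q])
    obtain f where f: "f \<in> borel_measurable borel" "\<And>x. 0 \<le> f x"
      and dom: "AE x in lebesgue. \<bar>sum_indicators \<Omega> x\<bar> \<le> f x"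
      and osc: "\<And>P. P \<in> cubes \<Longrightarrow>
        \<exists>c. (\<integral>\<^sup>+x. ennreal \<bar>f x - c\<bar> * indicator P x \<partial>lebesgue) \<le> ennreal K1 * emeasure lebesgue P"
      and int_Q: "(\<integral>\<^sup>+x. ennreal (f x) * indicator Q x \<partial>lebesgue) \<le> ennreal K2 * emeasure lebesgue Q"
      by (rule thin_chain_majorant[OF Q \<Omega>, folded L_def, folded K1_def K2_def]) (rule that)
    have f_meas [measurable]: "f \<in> borel_measurable lebesgue"
      using f(1) by (intro measurable_completion) simp
    obtain H where H: "H \<in> sets lebesgue" "H \<subseteq> Q" "measure lebesgue H = measure lebesgue Q / 2"
      using half_cube[OF Q] .
    define q where "q = measure lebesgue Q"
    have "0 < q" using measure_cube_pos[OF Q] by (simp add: q_def)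
    have em_Q: "emeasure lebesgue Q = ennreal q"
      unfolding q_def by (rule emeasure_cube[OF Q])
    have lmeas: "S \<in> lmeasurable" if "S \<in> sets lebesgue" "S \<subseteq> Q" for S
    proof -
      have "Q \<in> lmeasurable"
        by (intro fmeasurableI sets_cube[OF Q]) (simp add: em_Q del: emeasure_completion)
      then show ?thesis
        using that by (blast intro: fmeasurableI2)
    qed
    \<comment> \<open>By Markov's inequality f exceeds four times the bound for its mean on at most
      a quarter of Q, so removing G leaves at least half of H.\<close>
    define G where "G = {x \<in> Q. 4 * K2 < f x}"
    have G: "G \<in> sets lebesgue" "G \<subseteq> Q"
      using sets_cube[OF Q] by (auto simp: G_def)
    have "measure lebesgue G \<le> q / 4"
    proof -
      have "ennreal (4 * K2) * emeasure lebesgue G = (\<integral>\<^sup>+x. ennreal (4 * K2) * indicator G x \<partial>lebesgue)"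
        using G(1) by (rule nn_integral_cmult_indicator[symmetric])
      also have "\<dots> \<le> (\<integral>\<^sup>+x. ennreal (f x) * indicator Q x \<partial>lebesgue)"
        by (intro nn_integral_mono) (auto simp: G_def indicator_def intro: ennreal_leI)
      also have "\<dots> \<le> ennreal (K2 * q)"
        using int_Q pos by (simp add: em_Q ennreal_mult' del: emeasure_completion)
      finally have "4 * K2 * measure lebesgue G \<le> K2 * q"
        using pos \<open>0 < q\<close> lmeas[OF G]
        by (simp add: emeasure_eq_measure2 ennreal_mult'[symmetric] del: emeasure_completion measure_completion)
      then show ?thesis using pos by simp
    qed
    define F where "F = H - G"
    have F: "F \<in> sets lebesgue" "F \<subseteq> Q"
      using H G by (auto simp: F_def)
    define \<theta> where "\<theta> = measure lebesgue F / q"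
    have \<theta>: "1 / 4 \<le> \<theta>" "\<theta> \<le> 1 / 2"
    proof -
      have "measure lebesgue H \<le> measure lebesgue (F \<union> G)"
        using H(1) F G by (intro measure_mono_fmeasurable lmeas) (auto simp: F_def)
      also have "\<dots> \<le> measure lebesgue F + measure lebesgue G"
        using F G by (intro measure_Un_le) auto
      finally have "q / 4 \<le> measure lebesgue F"
        using H(3) \<open>measure lebesgue G \<le> q / 4\<close> by (simp add: q_def del: measure_completion)
      then show "1 / 4 \<le> \<theta>"
        using \<open>0 < q\<close> by (simp add: \<theta>_def field_simps)
      have "measure lebesgue F \<le> measure lebesgue H"
        using H(1,2) F by (intro measure_mono_fmeasurable lmeas) (auto simp: F_def)
      then show "\<theta> \<le> 1 / 2"
        using H(3) \<open>0 < q\<close> by (simp add: \<theta>_def q_def field_simps)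
    qed
    have f_int: "integrable (lebesgue_on Q) f"
      using osc[OF Q] integrable_on_cube_if_mean_oscillation[OF f_meas Q] by blast
    define m where "m = average Q f"
    have m: "m \<le> K2"
    proof -
      have "ennreal m * ennreal q \<le> ennreal K2 * ennreal q"
        using nn_integral_cube_eq_average[OF Q f_int] int_Q f(2) by (simp add: m_def em_Q del: emeasure_completion)
      then show ?thesis
        using pos \<open>0 < q\<close> by (simp add: ennreal_mult''[symmetric])
    qed
    define h where "h x = f x - A * indicator F x" for x
    have h_meas: "h \<in> borel_measurable lebesgue"
      unfolding h_def[abs_def] using F(1) by measurable
    have h_avg: "average Q h = m - A * \<theta>"
    proof -
      have int_F: "integrable (lebesgue_on Q) (indicator F :: _ \<Rightarrow> real)"
        using F sets_cube[OF Q] em_Q lmeas[OF F]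
        by (intro integrable_real_indicator) (auto simp: sets_restrict_space_iff emeasure_restrict_space fmeasurable_def simp del: emeasure_completion)
      have "(\<integral>x. h x \<partial>lebesgue_on Q) = (\<integral>x. f x \<partial>lebesgue_on Q) - A * measure lebesgue F"
        unfolding h_def using f_int int_F F sets_cube[OF Q]
        by (subst Bochner_Integration.integral_diff)
           (auto simp: measure_restrict_space space_restrict_space Int_absorb2 simp del: measure_completion)
      then show ?thesis
        by (simp add: average_def m_def \<theta>_def q_def diff_divide_distrib del: measure_completion)
    qed
    \<comment> \<open>Subtracting a function with values 0 and A raises the mean deviation from the
      same constant c by at most A.\<close>
    have osc_h: "\<exists>c. (\<integral>\<^sup>+x. ennreal \<bar>h x - c\<bar> * indicator P x \<partial>lebesgue) \<le> ennreal (K1 + A) * emeasure lebesgue P"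
      if P: "P \<in> cubes" for P
    proof -
      obtain c where c: "(\<integral>\<^sup>+x. ennreal \<bar>f x - c\<bar> * indicator P x \<partial>lebesgue) \<le> ennreal K1 * emeasure lebesgue P"
        using osc[OF P] by blast
      have "(\<integral>\<^sup>+x. ennreal \<bar>h x - c\<bar> * indicator P x \<partial>lebesgue)
          \<le> (\<integral>\<^sup>+x. ennreal \<bar>f x - c\<bar> * indicator P x + ennreal A * indicator P x \<partial>lebesgue)"
      proof (rule nn_integral_mono)
        fix x
        have "\<bar>h x - c\<bar> \<le> \<bar>f x - c\<bar> + A"
          using pos(3) by (auto simp: h_def indicator_def)
        then have "ennreal \<bar>h x - c\<bar> \<le> ennreal \<bar>f x - c\<bar> + ennreal A"
          using pos(3) by (subst ennreal_plus[symmetric]) (auto intro: ennreal_leI simp del: ennreal_plus)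
        then show "ennreal \<bar>h x - c\<bar> * indicator P x \<le> ennreal \<bar>f x - c\<bar> * indicator P x + ennreal A * indicator P x"
          by (auto simp: indicator_def)
      qed
      also have "\<dots> = (\<integral>\<^sup>+x. ennreal \<bar>f x - c\<bar> * indicator P x \<partial>lebesgue) + ennreal A * emeasure lebesgue P"
        using sets_cube[OF P] by (subst nn_integral_add) (auto simp: nn_integral_cmult_indicator)
      also have "\<dots> \<le> ennreal K1 * emeasure lebesgue P + ennreal A * emeasure lebesgue P"
        using c by (rule add_right_mono)
      also have "\<dots> = ennreal (K1 + A) * emeasure lebesgue P"
        using pos by (simp add: distrib_right del: emeasure_completion)
      finally show ?thesis by blast
    qed
    have h: "h \<in> BMO" "bmo_norm h \<le> ennreal (2 * (K1 + A))"
      using BMO_if_mean_oscillation[OF h_meas _ osc_h] pos by auto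
    have f_le: "f x \<le> \<bar>h x - average Q h\<bar>" if "x \<in> Q" for x
    proof (cases "x \<in> F")
      case True
      then have "f x \<le> 4 * K2"
        by (auto simp: F_def G_def \<open>x \<in> Q\<close>)
      moreover have "0 \<le> m"
        unfolding m_def average_def using f(2) by (intro divide_nonneg_nonneg integral_nonneg_AE) auto
      moreover have "A * \<theta> \<le> A * (1 / 2)"
        using \<theta>(2) pos by (intro mult_left_mono) auto
      moreover have "h x - average Q h = f x - m - A + A * \<theta>"
        using True by (simp add: h_def h_avg)
      ultimately show ?thesis
        unfolding A_def by linarith
    next
      case False
      have "A * (1 / 4) \<le> A * \<theta>"
        using \<theta>(1) pos by (intro mult_left_mono) auto
      moreover have "h x - average Q h = f x - m + A * \<theta>"
        using False by (simp add: h_def h_avg)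
      ultimately show ?thesis
        using m pos(2) unfolding A_def by linarith
    qed
    have "ext_qnorm (X Q) (sum_indicators \<Omega>) \<le> ext_qnorm (X Q) (\<lambda>x. h x - average Q h)"
    proof (rule ext_qnorm_mono)
      show "sum_indicators \<Omega> \<in> borel_measurable (lebesgue_on Q)"
        by (intro measurable_restrict_space1 borel_measurable_sum_indicators[OF \<Omega>])
      have "AE x in lebesgue. x \<in> Q \<longrightarrow> \<bar>sum_indicators \<Omega> x\<bar> \<le> \<bar>h x - average Q h\<bar>"
        using dom by eventually_elim (use f_le order_trans in blast)
      then show "AE x in lebesgue_on Q. \<bar>sum_indicators \<Omega> x\<bar> \<le> \<bar>h x - average Q h\<bar>"
        using sets_cube[OF Q] by (subst AE_restrict_space_iff) auto
    qed
    also have "\<dots> \<le> bmo_norm_on X h"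
      unfolding bmo_norm_on_def using Q by (rule SUP_upper)
    also have "\<dots> \<le> ennreal C * ennreal (2 * (K1 + A))"
      using C(2)[OF h(1)] h(2) by (meson mult_left_mono order_trans zero_le)
    also have "\<dots> = ennreal (C * (2 * (K1 + A)))"
      using C(1) by (simp add: ennreal_mult')
    finally show "ext_qnorm (X Q) (sum_indicators \<Omega>) \<le> ennreal (C * (2 * (K1 + A)))" .
  qed
  then show ?thesis
    using C(1) pos by (intro exI[of _ "C * (2 * (K1 + A))"]) auto
qed

theorem theorem1p1:
  fixes X :: "(real ^ 'n) set \<Rightarrow> (real ^ 'n) fspace"
  assumes "normalized_family X"
  shows
    "((\<exists>C :: real. 0 < C \<and>
        (\<forall>f \<in> BMO. f \<in> BMO_on X \<and> bmo_norm_on X f \<le> ennreal C * bmo_norm f))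
      \<longleftrightarrow>
      (\<exists>C :: real. 0 < C \<and>
        (\<forall>Q \<in> cubes. \<forall>\<Omega> :: nat \<Rightarrow> (real ^ 'n) set.
          (\<forall>k. \<Omega> k \<in> sets lebesgue \<and> \<Omega> k \<subseteq> Q \<and> \<Omega> (Suc k) \<subseteq> \<Omega> k \<and>
               measure lebesgue (\<Omega> k) \<le> (1 / 2) ^ k * measure lebesgue Q) \<longrightarrow>
          ext_qnorm (X Q) (sum_indicators \<Omega>) \<le> ennreal C)))
     \<and>
     ((\<exists>C :: real. 0 < C \<and>
        (\<forall>Q \<in> cubes. \<forall>\<Omega> :: nat \<Rightarrow> (real ^ 'n) set.
          (\<forall>k. \<Omega> k \<in> sets lebesgue \<and> \<Omega> k \<subseteq> Q \<and> \<Omega> (Suc k) \<subseteq> \<Omega> k \<and>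
               measure lebesgue (\<Omega> k) \<le> (1 / 2) ^ k * measure lebesgue Q) \<longrightarrow>
          ext_qnorm (X Q) (sum_indicators \<Omega>) \<le> ennreal C))
      \<longleftrightarrow>
      (\<exists>C :: real. 0 < C \<and>
        (\<forall>Q \<in> cubes. \<forall>f \<in> expL Q.
          f \<in> funs (X Q) \<and> ext_qnorm (X Q) f \<le> ennreal C * expL_norm Q f)))"
  (is "(?BMO \<longleftrightarrow> ?chain) \<and> (?chain \<longleftrightarrow> ?expL)")
proof -
  have X: "quasi_banach_function_space Q (X Q)" if "Q \<in> cubes" for Q
    using assms that by (simp add: normalized_family_def)
  have chain: "?chain \<longleftrightarrow> (\<exists>C>0. chain_bound X C)"
    unfolding chain_bound_def thin_chain_def ..
  have "?BMO \<Longrightarrow> ?chain"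
    unfolding chain using BMO_embedding_imp_chain_bound[OF X] by blast
  moreover have ?BMO if bound: ?chain
  proof -
    obtain C where C: "chain_bound X C" "0 < C"
      using bound unfolding chain by blast
    show ?BMO
      using chain_bound_imp_BMO_embedding[OF X C] C(2)
      by (intro exI[of _ "C * 2 ^ (CARD('n) + 1)"]) auto
  qed
  moreover have ?expL if bound: ?chain
  proof -
    obtain C where C: "chain_bound X C" "0 < C"
      using bound unfolding chain by blast
    show ?expL
      using chain_bound_imp_expL_embedding[where X = X, OF X C] C(2)
      by (intro exI[of _ "C * ln 3"]) auto
  qed
  moreover have ?chain if embedding: ?expL
  proof -
    obtain C where C: "0 < C" "\<And>Q f. Q \<in> cubes \<Longrightarrow> f \<in> expL Q \<Longrightarrow> ext_qnorm (X Q) f \<le> ennreal C * expL_norm Q f"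
      using embedding by blast
    have "chain_bound X (C / ln (4 / 3))"
      using C by (rule expL_embedding_imp_chain_bound)
    then show ?chain
      unfolding chain using C(1) by (intro exI[of _ "C / ln (4 / 3)"]) auto
  qed
  ultimately show ?thesis by blast
qed

end
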